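(* Let $\alpha_v^{ij}=-\beta(1-\delta_{ij})$ for some $\beta>0$ and all $v\in[d]$ and $i,j\in[m]$, where $\delta_{ij}$ is Kronecker's delta. Suppose that at least one of the following conditions is satisfied: (C1) $d=2$, $m\ge2$ and $\beta\le2$; (C2) $d\ge2$, $m\ge2$ and $\beta<\dfrac{4}{d(m-1)}$. Then the process of vertex occupation measures $X=\{X(n)\}_{n\ge0}$ of the $m$ interacting walks on $[d]$ with parameters $\alpha_v^{ij}$ converges almost surely to $\big(\frac1d,\frac1d,\dots,\frac1d\big)\in\mathbb{R}^{dm}$.
   Context: Notation: $[n]=\{1,\dots,n\}$. Points of $\mathbb{R}^{dm}$ are written $x=(x_v^i)_{i\in[m],v\in[d]}$, and $$\pi_v^i(x)=\frac{\exp\big(\sum_{j=1}^m\alpha_v^{ij}x_v^j\big)}{\sum_{u=1}^d\exp\big(\sum_{j=1}^m\alpha_u^{ij}x_u^j\big)}.$$ The process: $W(n)=(W^1(n),\dots,W^m(n))$, $n\ge1$, takes values in $[d]^m$ ($m$ walks on the complete graph with vertex set $[d]$). Set $X_v^i(0)=1$ and, for $n\ge1$, $X_v^i(n)=\frac{1}{d+n}\big(1+\sum_{k=1}^n\mathbf{1}\{W^i(k)=v\}\big)$. Let $\mathfrak{F}_0$ be the trivial $\sigma$-algebra and $\mathfrak{F}_n=\sigma(W(k):1\le k\le n)$. For all $n\ge0$, $i\in[m]$, $v\in[d]$, $\mathbb{P}(W^i(n+1)=v\mid\mathfrak{F}_n)=\pi_v^i(X(n))$, and $W^1(n+1),\dots,W^m(n+1)$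 are conditionally independent given $\mathfrak{F}_n$. $X(n)=(X_v^i(n))_{i,v}\in\mathbb{R}^{dm}$. *)

theory Defs
  imports "HOL-Probability.Probability"
begin

text \<open>
  The number of walks and the number of vertices are the cardinalities of the finite index types
  \<open>'m\<close> and \<open>'d\<close>. Points \<open>(x\<^sub>v\<^sup>i)\<close> of the Euclidean space of dimension \<open>CARD('d) * CARD('m)\<close> are
  elements of \<^typ>\<open>real ^ 'd ^ 'm\<close>, with \<open>x\<^sub>v\<^sup>i\<close> written \<open>x $ i $ v\<close>; the parameter
  \<open>\<alpha>\<^sub>v\<^sup>i\<^sup>j\<close> is written \<open>\<alpha> v i j\<close>, and \<open>W n \<omega> i\<close> is the position of walk \<open>i\<close> at time \<open>n\<close>.
\<close>

definition transition_prob ::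
  "('d::finite \<Rightarrow> 'm::finite \<Rightarrow> 'm \<Rightarrow> real) \<Rightarrow> real ^ 'd ^ 'm \<Rightarrow> 'm \<Rightarrow> 'd \<Rightarrow> real"
where
  "transition_prob \<alpha> x i v =
     exp (\<Sum>j\<in>UNIV. \<alpha> v i j * x $ j $ v) / (\<Sum>u\<in>UNIV. exp (\<Sum>j\<in>UNIV. \<alpha> u i j * x $ j $ u))"

text \<open>
  At time 0 every coordinate is 1; this is a separate convention and not the value \<open>1 / d\<close> that
  the formula for positive times would give.
\<close>

definition occupation_measure ::
  "(nat \<Rightarrow> 'a \<Rightarrow> 'm::finite \<Rightarrow> 'd::finite) \<Rightarrow> nat \<Rightarrow> 'a \<Rightarrow> real ^ 'd ^ 'm"
where
  "occupation_measure W n \<omega> =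
     (\<chi> i v. if n = 0 then 1
             else (1 + (\<Sum>k=1..n. of_bool (W k \<omega> i = v))) / (real CARD('d) + real n))"

definition walk_history ::
  "'a measure \<Rightarrow> (nat \<Rightarrow> 'a \<Rightarrow> 'm \<Rightarrow> 'd) \<Rightarrow> nat \<Rightarrow> 'a measure"
where
  "walk_history M W n = sigma (space M) {W k -` A \<inter> space M |k A. 1 \<le> k \<and> k \<le> n}"

definition cond_prob_given :: "'a measure \<Rightarrow> 'a measure \<Rightarrow> 'a set \<Rightarrow> 'a \<Rightarrow> real" where
  "cond_prob_given M F A = real_cond_exp M F (indicator A)"

definition cond_indep_vars_given ::
  "'a measure \<Rightarrow> 'a measure \<Rightarrow> ('i \<Rightarrow> 'b measure) \<Rightarrow> ('i \<Rightarrow> 'a \<Rightarrow> 'b) \<Rightarrow> 'i set \<Rightarrow> bool"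
where
  "cond_indep_vars_given M F N Y I \<longleftrightarrow>
     (\<forall>i\<in>I. Y i \<in> measurable M (N i)) \<and>
     (\<forall>J A. J \<subseteq> I \<longrightarrow> finite J \<longrightarrow> J \<noteq> {} \<longrightarrow> (\<forall>i\<in>J. A i \<in> sets (N i)) \<longrightarrow>
        (AE \<omega> in M. cond_prob_given M F (\<Inter>i\<in>J. Y i -` A i \<inter> space M) \<omega> =
                    (\<Prod>i\<in>J. cond_prob_given M F (Y i -` A i \<inter> space M) \<omega>)))"

locale interacting_walks = prob_space M
  for M :: "'a measure" +
  fixes \<alpha> :: "'d::finite \<Rightarrow> 'm::finite \<Rightarrow> 'm \<Rightarrow> real"
    and W :: "nat \<Rightarrow> 'a \<Rightarrow> 'm \<Rightarrow> 'd"
  assumes walk_measurable: "1 \<le> n \<Longrightarrow> W n \<in> measurable M (count_space UNIV)"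
    and walk_transition:
      "AE \<omega> in M. cond_prob_given M (walk_history M W n) {\<omega> \<in> space M. W (Suc n) \<omega> i = v} \<omega> =
                  transition_prob \<alpha> (occupation_measure W n \<omega>) i v"
    and walk_cond_indep:
      "cond_indep_vars_given M (walk_history M W n) (\<lambda>_. count_space UNIV)
         (\<lambda>i \<omega>. W (Suc n) \<omega> i) UNIV"

end

theory Submission imports Defs begin

text \<open>
  The occupation measures perform a stochastic approximation
  \<open>X (n + 1) = X n + \<gamma> n * (e - X n)\<close>, where \<open>\<gamma> n\<close> is of order \<open>1 / n\<close> and \<open>e\<close> is the random vertex of
  the product of simplices given by the next positions. The conditional mean of \<open>e\<close> is
  \<open>p = softmax (A (X n))\<close>, where \<open>A\<close> is the symmetric linear map with entries \<open>\<alpha>\<close>, so on average the process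
  follows the flow of the vector field \<open>p - x\<close>.

  For every symmetric \<open>\<alpha>\<close> this flow has a Lyapunov function, the free energy
  \<open>\<Sum> p ln p - \<langle>p, A p\<rangle> / 2\<close> evaluated at \<open>p = softmax (A x)\<close>. It is smooth up to the boundary of the
  simplices, and along the flow it decreases at the rate \<open>D x\<close>, the sum over the walks of the variance
  of the defect \<open>A (x - p)\<close> under \<open>p\<close> (\<open>sum_energy_gradient_drift\<close>). Taking expectations of a second-order expansion
  of the energy along the process gives \<open>\<Sum> \<gamma> n * E (D (X n)) < \<infinity>\<close>. So
  \<open>\<Sum> \<gamma> n * D (X n)\<close> is almost surely finite, and because \<open>D (X n)\<close> changes by at most a multiple of \<open>\<gamma> n\<close>
  per step it must tend to zero (\<open>dissipation_tendsto_0\<close>).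

  By compactness it remains to see that the uniform point is the only zero of \<open>D\<close> on the simplices. At a
  zero, \<open>p\<close> is an equilibrium, that is \<open>p = softmax (A p)\<close>. Both conditions of the theorem imply \<open>\<beta> \<le> 2\<close>, and this bound makes
  the free energy convex: Jeffreys' divergence between two positive probability vectors is at least twice
  their squared Euclidean distance, strictly so if they differ (\<open>jeffreys_divergence_gt\<close>), which outweighs the
  concave part of the interaction. Hence \<open>p\<close> is uniform (\<open>repelling_equilibrium_uniform\<close>), and with at
  least two walks so is \<open>x\<close> (\<open>repelling_dissipation_eq_0_imp\<close>).
\<close>

section \<open>Lipschitz functions on compact sets\<close>

text \<open>
  The Lipschitz constant is left existential because only its existence matters below, and because
  the resulting predicate is closed under the operations that build the energy of the process.
\<close>

definition lipschitzian :: "'a::metric_space set \<Rightarrow> ('a \<Rightarrow> real) \<Rightarrow> bool" where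
  "lipschitzian K f \<longleftrightarrow> (\<exists>L. L-lipschitz_on K f)"

lemma lipschitzianE:
  assumes "lipschitzian K f"
  obtains L where "L \<ge> 0" "\<And>x y. x \<in> K \<Longrightarrow> y \<in> K \<Longrightarrow> \<bar>f x - f y\<bar> \<le> L * dist x y"
  using assms unfolding lipschitzian_def lipschitz_on_def dist_real_def by blast

lemma lipschitzianI:
  assumes "\<And>x y. x \<in> K \<Longrightarrow> y \<in> K \<Longrightarrow> \<bar>f x - f y\<bar> \<le> L * dist x y"
  shows "lipschitzian K f"
  unfolding lipschitzian_def
proof (intro exI lipschitz_onI)
  show "dist (f x) (f y) \<le> max L 0 * dist x y" if "x \<in> K" "y \<in> K" for x y
    using assms[OF that] mult_right_mono[of L "max L 0" "dist x y"] by (simp add: dist_real_def)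
qed simp

lemma lipschitzian_continuous_on: "lipschitzian K f \<Longrightarrow> continuous_on K f"
  unfolding lipschitzian_def using lipschitz_on_continuous_on by blast

lemma lipschitzian_bounded:
  assumes "lipschitzian K f" "compact K"
  obtains B where "B > 0" "\<And>x. x \<in> K \<Longrightarrow> \<bar>f x\<bar> \<le> B"
proof -
  have "bounded (f ` K)"
    using assms compact_continuous_image lipschitzian_continuous_on compact_imp_bounded by blast
  then obtain B where "B > 0" "\<forall>y\<in>f ` K. norm y \<le> B" by (auto simp: bounded_pos)
  then show ?thesis using that by auto
qed

lemma lipschitzian_const: "lipschitzian K (\<lambda>_. c)"
  by (rule lipschitzianI[where L = 0]) simp

lemma lipschitzian_add:
  assumes "lipschitzian K f" "lipschitzian K g" shows "lipschitzian K (\<lambda>x. f x + g x)"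
  using assms lipschitz_on_add unfolding lipschitzian_def by blast

lemma lipschitzian_diff:
  assumes "lipschitzian K f" "lipschitzian K g" shows "lipschitzian K (\<lambda>x. f x - g x)"
  using assms lipschitz_on_diff unfolding lipschitzian_def by blast

lemma lipschitzian_sum:
  assumes "\<And>i. i \<in> I \<Longrightarrow> lipschitzian K (f i)"
  shows "lipschitzian K (\<lambda>x. \<Sum>i\<in>I. f i x)"
  using assms
  by (induction I rule: infinite_finite_induct) (auto intro: lipschitzian_const lipschitzian_add)

text \<open>
  Compactness supplies the bounds on the two factors without which a product of Lipschitz functions
  need not be Lipschitz.
\<close>

lemma lipschitzian_mult:
  assumes "compact K" "lipschitzian K f" "lipschitzian K g"
  shows "lipschitzian K (\<lambda>x. f x * g x)"
proof -
  obtain L where L: "L \<ge> 0" "\<And>x y. x \<in> K \<Longrightarrow> y \<in> K \<Longrightarrow> \<bar>f x - f y\<bar> \<le> L * dist x y"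
    using assms(2) lipschitzianE by blast
  obtain M where M: "M \<ge> 0" "\<And>x y. x \<in> K \<Longrightarrow> y \<in> K \<Longrightarrow> \<bar>g x - g y\<bar> \<le> M * dist x y"
    using assms(3) lipschitzianE by blast
  obtain B where B: "B > 0" "\<And>x. x \<in> K \<Longrightarrow> \<bar>f x\<bar> \<le> B"
    using lipschitzian_bounded assms by blast
  obtain C where C: "C > 0" "\<And>x. x \<in> K \<Longrightarrow> \<bar>g x\<bar> \<le> C"
    using lipschitzian_bounded assms by blast
  show ?thesis
  proof (rule lipschitzianI[where L = "B * M + L * C"])
    fix x y assume x: "x \<in> K" and y: "y \<in> K"
    have "f x * g x - f y * g y = f x * (g x - g y) + (f x - f y) * g y"
      by (simp add: algebra_simps)
    then have "\<bar>f x * g x - f y * g y\<bar> \<le> \<bar>f x\<bar> * \<bar>g x - g y\<bar> + \<bar>f x - f y\<bar> * \<bar>g y\<bar>"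
      by (metis abs_mult abs_triangle_ineq)
    also have "\<dots> \<le> B * (M * dist x y) + (L * dist x y) * C"
      using B C L(2)[OF x y] M(2)[OF x y] x y L(1) M(1)
      by (intro add_mono mult_mono) (simp_all add: less_imp_le)
    finally show "\<bar>f x * g x - f y * g y\<bar> \<le> (B * M + L * C) * dist x y"
      by (simp add: algebra_simps)
  qed
qed

text \<open>
  The values of \<open>f\<close> on \<open>K\<close> have a compact convex hull inside the domain \<open>S\<close> of \<open>\<phi>\<close>, and on that hull
  the continuous derivative of \<open>\<phi>\<close> is bounded. This covers the exponential, the logarithm and the
  reciprocal at once.
\<close>

lemma lipschitzian_compose_C1:
  fixes \<phi> \<phi>' :: "real \<Rightarrow> real"
  assumes "compact K" "lipschitzian K f"
    and "\<And>x. x \<in> K \<Longrightarrow> f x \<in> S" "convex S"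
    and deriv: "\<And>t. t \<in> S \<Longrightarrow> (\<phi> has_real_derivative \<phi>' t) (at t)"
    and cont: "continuous_on S \<phi>'"
  shows "lipschitzian K (\<lambda>x. \<phi> (f x))"
proof -
  define H where "H = convex hull (f ` K)"
  have "compact (f ` K)"
    using assms(1,2) by (intro compact_continuous_image lipschitzian_continuous_on)
  then have H: "compact H" "convex H" "f ` K \<subseteq> H"
    unfolding H_def by (simp_all add: compact_convex_hull hull_subset)
  have "H \<subseteq> S" unfolding H_def using assms(3,4) by (intro hull_minimal) blast+
  have "bounded (\<phi>' ` H)"
    using compact_continuous_image[OF continuous_on_subset[OF cont \<open>H \<subseteq> S\<close>] H(1)]
    by (rule compact_imp_bounded)
  then obtain B where B: "B > 0" "\<forall>y\<in>\<phi>' ` H. norm y \<le> B" by (auto simp: bounded_pos)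
  obtain L where L: "L \<ge> 0" "\<And>x y. x \<in> K \<Longrightarrow> y \<in> K \<Longrightarrow> \<bar>f x - f y\<bar> \<le> L * dist x y"
    using assms(2) lipschitzianE by blast
  show ?thesis
  proof (rule lipschitzianI[where L = "B * L"])
    fix x y assume x: "x \<in> K" and y: "y \<in> K"
    have "norm (\<phi> (f x) - \<phi> (f y)) \<le> B * norm (f x - f y)"
    proof (rule field_differentiable_bound[OF \<open>convex H\<close>])
      show "(\<phi> has_field_derivative \<phi>' t) (at t within H)" if "t \<in> H" for t
        by (rule has_field_derivative_at_within[OF deriv[OF subsetD[OF \<open>H \<subseteq> S\<close> that]]])
      show "norm (\<phi>' t) \<le> B" if "t \<in> H" for t using B(2) that by blast
      show "f x \<in> H" "f y \<in> H" using H(3) x y by blast+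
    qed
    also have "\<dots> \<le> B * (L * dist x y)"
      using L(2)[OF x y] B(1) by (intro mult_left_mono) simp_all
    finally show "\<bar>\<phi> (f x) - \<phi> (f y)\<bar> \<le> B * L * dist x y" by simp
  qed
qed

lemma lipschitzian_exp:
  assumes "compact K" "lipschitzian K f" shows "lipschitzian K (\<lambda>x. exp (f x))"
  using continuous_on_exp[OF continuous_on_id]
  by (rule lipschitzian_compose_C1[OF assms UNIV_I convex_UNIV DERIV_exp])

lemma lipschitzian_ln:
  assumes "compact K" "lipschitzian K f" "\<And>x. x \<in> K \<Longrightarrow> f x > 0"
  shows "lipschitzian K (\<lambda>x. ln (f x))"
proof (rule lipschitzian_compose_C1[OF assms(1,2)])
  show "continuous_on {0<..} (inverse :: real \<Rightarrow> real)" by (intro continuous_intros) auto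
  show "(ln has_real_derivative inverse t) (at t)" if "t \<in> {0<..}" for t :: real
    using that by (simp add: DERIV_ln)
qed (use assms(3) in auto)

lemma lipschitzian_divide:
  assumes "compact K" "lipschitzian K f" "lipschitzian K g" "\<And>x. x \<in> K \<Longrightarrow> g x > 0"
  shows "lipschitzian K (\<lambda>x. f x / g x)"
proof -
  have "lipschitzian K (\<lambda>x. inverse (g x))"
  proof (rule lipschitzian_compose_C1[OF assms(1,3)])
    show "continuous_on {0<..} (\<lambda>t::real. - (inverse t ^ Suc (Suc 0)))"
      by (intro continuous_intros) auto
    show "(inverse has_real_derivative - (inverse t ^ Suc (Suc 0))) (at t)"
      if "t \<in> {0<..}" for t :: real
      using that DERIV_inverse[of t UNIV] by simp
  qed (use assms(4) in auto)
  then show ?thesis using lipschitzian_mult[OF assms(1,2)] by (simp add: divide_inverse)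
qed

section \<open>Limits from weighted sums and from compactness\<close>

text \<open>
  Divergence of \<open>\<Sum>\<gamma> n\<close> and convergence of \<open>\<Sum>\<gamma> n * D n\<close> only force \<open>D\<close> to be small along a
  subsequence. The increments of \<open>D\<close> itself need not be summable, but those of \<open>D\<^sup>2\<close> are: they
  are at most \<open>L * \<gamma> n * (2 * D n + L * \<gamma> n)\<close>, a combination of the two given convergent series. Hence
  \<open>D\<^sup>2\<close> converges, and a positive limit would contradict the divergence of \<open>\<Sum>\<gamma> n\<close>.
\<close>

lemma null_sequence_of_slow_variation:
  fixes \<gamma> D :: "nat \<Rightarrow> real"
  assumes \<gamma>: "\<And>n. \<gamma> n \<ge> 0" "\<not> summable \<gamma>" "summable (\<lambda>n. \<gamma> n ^ 2)"
    and D: "\<And>n. D n \<ge> 0" "summable (\<lambda>n. \<gamma> n * D n)"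
    and slow: "\<And>n. \<bar>D (Suc n) - D n\<bar> \<le> L * \<gamma> n"
  shows "D \<longlonglongrightarrow> 0"
proof -
  have "\<bar>D (Suc n) ^ 2 - D n ^ 2\<bar> \<le> L * 2 * (\<gamma> n * D n) + L ^ 2 * \<gamma> n ^ 2" for n
  proof -
    have L0: "0 \<le> L * \<gamma> n" using slow[of n] by linarith
    have "\<bar>D (Suc n) ^ 2 - D n ^ 2\<bar> = \<bar>D (Suc n) - D n\<bar> * (D (Suc n) + D n)"
      using D(1)[of n] D(1)[of "Suc n"]
      by (simp add: power2_eq_square square_diff_square_factored abs_mult)
    also have "\<dots> \<le> (L * \<gamma> n) * (2 * D n + L * \<gamma> n)"
      using slow[of n] D(1)[of n] D(1)[of "Suc n"] L0 by (intro mult_mono) auto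
    finally show ?thesis by (simp add: power2_eq_square algebra_simps)
  qed
  then have "norm (D (Suc n) ^ 2 - D n ^ 2) \<le> L * 2 * (\<gamma> n * D n) + L ^ 2 * \<gamma> n ^ 2" for n
    unfolding real_norm_def .
  moreover have "summable (\<lambda>n. L * 2 * (\<gamma> n * D n) + L ^ 2 * \<gamma> n ^ 2)"
    by (rule summable_add[OF summable_mult[OF D(2)] summable_mult[OF \<gamma>(3)]])
  ultimately have "summable (\<lambda>n. D (Suc n) ^ 2 - D n ^ 2)"
    by (rule summable_comparison_test'[where N = 0, rotated])
  then have "(\<lambda>N. (\<Sum>n<N. D (Suc n) ^ 2 - D n ^ 2) + D 0 ^ 2)
      \<longlonglongrightarrow> (\<Sum>n. D (Suc n) ^ 2 - D n ^ 2) + D 0 ^ 2"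
    by (intro tendsto_add summable_LIMSEQ tendsto_const)
  then obtain l where l: "(\<lambda>n. D n ^ 2) \<longlonglongrightarrow> l"
    by (auto simp: sum_lessThan_telescope[of "\<lambda>n. D n ^ 2"])
  have sq: "(\<lambda>n. sqrt (D n ^ 2)) \<longlonglongrightarrow> sqrt l" by (intro tendsto_intros l)
  then have conv: "D \<longlonglongrightarrow> sqrt l" using D(1) by simp
  have "sqrt l = 0"
  proof (rule ccontr)
    assume "sqrt l \<noteq> 0"
    moreover have "sqrt l \<ge> 0" using conv D(1) by (intro LIMSEQ_le_const) auto
    ultimately have pos: "sqrt l > 0" by simp
    then have half: "sqrt l / 2 < sqrt l" by simp
    have "summable \<gamma>"
    proof (rule summable_comparison_test_ev)
      show "\<forall>\<^sub>F n in sequentially. norm (\<gamma> n) \<le> (2 / sqrt l) * (\<gamma> n * D n)"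
        using order_tendstoD(1)[OF conv half]
      proof eventually_elim
        case (elim n)
        then have "1 \<le> 2 / sqrt l * D n" using pos by (simp add: field_simps)
        then have "\<gamma> n * 1 \<le> \<gamma> n * (2 / sqrt l * D n)" by (rule mult_left_mono[OF _ \<gamma>(1)])
        then show ?case using \<gamma>(1)[of n] by (simp add: ac_simps)
      qed
      show "summable (\<lambda>n. (2 / sqrt l) * (\<gamma> n * D n))" using D(2) by (rule summable_mult)
    qed
    then show False using \<gamma>(2) by simp
  qed
  then show ?thesis using conv by simp
qed

lemma tendsto_unique_zero_compact:
  fixes D :: "'a::metric_space \<Rightarrow> real"
  assumes K: "compact K" and D: "continuous_on K D" "\<And>x. x \<in> K \<Longrightarrow> D x \<ge> 0"
    and zero: "\<And>x. x \<in> K \<Longrightarrow> D x = 0 \<Longrightarrow> x = a"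
    and X: "\<And>n. X n \<in> K" and lim: "(\<lambda>n. D (X n)) \<longlonglongrightarrow> 0"
  shows "X \<longlonglongrightarrow> a"
proof (rule tendstoI)
  fix e :: real assume e: "e > 0"
  define H where "H = K - ball a e"
  have H: "compact H" unfolding H_def by (rule compact_diff[OF K open_ball])
  show "\<forall>\<^sub>F n in sequentially. dist (X n) a < e"
  proof (cases "H = {}")
    case True
    then have "X n \<in> ball a e" for n using X[of n] by (auto simp: H_def)
    then show ?thesis by (simp add: dist_commute)
  next
    case False
    have "continuous_on H D" using D(1) by (rule continuous_on_subset) (simp add: H_def)
    then obtain z where z: "z \<in> H" "\<And>y. y \<in> H \<Longrightarrow> D z \<le> D y"
      using continuous_attains_inf[OF H False] by blast
    have "z \<noteq> a" using z(1) e by (auto simp: H_def)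
    then have "D z > 0" using z(1) zero[of z] D(2)[of z] by (force simp: H_def)
    then have "\<forall>\<^sub>F n in sequentially. D (X n) < D z" by (rule order_tendstoD(2)[OF lim])
    then show ?thesis
    proof eventually_elim
      case (elim n)
      then have "X n \<notin> H" using z(2)[of "X n"] by linarith
      then show ?case using X[of n] by (simp add: H_def dist_commute)
    qed
  qed
qed

section \<open>A lower bound for Jeffreys' divergence\<close>

text \<open>
  The first term of the expansion of \<open>ln\<close> in powers of \<open>(t - 1) / (t + 1)\<close>. The difference of the two
  sides vanishes at 1 and has derivative \<open>(t - 1)\<^sup>2 / (t * (t + 1)\<^sup>2)\<close>.
\<close>

lemma ln_gt_rational:
  fixes t :: real
  assumes "t > 1"
  shows "ln t > 2 * (t - 1) / (t + 1)"
proof -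
  let ?f = "\<lambda>t::real. ln t - 2 * (t - 1) / (t + 1)"
  have "?f 1 < ?f t"
  proof (rule DERIV_pos_imp_increasing_open[OF assms])
    fix x :: real assume x: "1 < x" "x < t"
    have "(?f has_real_derivative 1 / x - (2 * (x + 1) - 2 * (x - 1) * 1) / (x + 1) ^ 2) (at x)"
      using x by (auto intro!: derivative_eq_intros simp: power2_eq_square)
    moreover have "1 / x - (2 * (x + 1) - 2 * (x - 1) * 1) / (x + 1) ^ 2
        = (x - 1) ^ 2 / (x * (x + 1) ^ 2)"
      using x by (simp add: divide_simps) (simp add: power2_eq_square algebra_simps)
    moreover have "(x - 1) ^ 2 / (x * (x + 1) ^ 2) > 0" using x by simp
    ultimately show "\<exists>y. (?f has_real_derivative y) (at x) \<and> y > 0" by metis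
  next
    show "continuous_on {1..t} ?f" by (intro continuous_intros) auto
  qed
  then show ?thesis by simp
qed

text \<open>
  The comparison of the logarithmic with the arithmetic mean, multiplied out so that no difference of
  logarithms is divided by.
\<close>

lemma ln_diff_mult_diff_gt:
  fixes a b :: real
  assumes "a > 0" "b > 0" "a \<noteq> b"
  shows "(ln a - ln b) * (a - b) > 2 * (a - b) ^ 2 / (a + b)"
proof -
  have gt: "(ln a - ln b) * (a - b) > 2 * (a - b) ^ 2 / (a + b)" if "0 < b" "b < a" for a b :: real
  proof -
    have "ln a - ln b > 2 * (a / b - 1) / (a / b + 1)"
      using ln_gt_rational[of "a / b"] that by (simp add: ln_div)
    also have "2 * (a / b - 1) / (a / b + 1) = 2 * (a - b) / (a + b)"
      using that by (simp add: divide_simps)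
    finally have "2 * (a - b) / (a + b) * (a - b) < (ln a - ln b) * (a - b)"
      using that by (intro mult_strict_right_mono) auto
    moreover have "2 * (a - b) / (a + b) * (a - b) = 2 * (a - b) ^ 2 / (a + b)"
      by (simp add: power2_eq_square)
    ultimately show ?thesis by argo
  qed
  show ?thesis
  proof (cases "b < a")
    case False
    then show ?thesis using gt[of a b] assms
      by (simp add: power2_commute add.commute algebra_simps)
  qed (use gt assms in auto)
qed

text \<open>
  When the entries sum to zero, each one is compensated by the others, so it is at most half of the
  \<open>\<ell>\<^sup>1\<close> norm in absolute value.
\<close>

lemma two_sum_squares_le_square_sum_abs:
  fixes f :: "'i \<Rightarrow> real"
  assumes "finite I" "(\<Sum>i\<in>I. f i) = 0"
  shows "2 * (\<Sum>i\<in>I. f i ^ 2) \<le> (\<Sum>i\<in>I. \<bar>f i\<bar>) ^ 2"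
proof -
  have *: "2 * \<bar>f i\<bar> \<le> (\<Sum>i\<in>I. \<bar>f i\<bar>)" if "i \<in> I" for i
  proof -
    have "f i = - (\<Sum>j\<in>I - {i}. f j)" using assms that by (simp add: sum_diff1)
    then have "\<bar>f i\<bar> \<le> (\<Sum>j\<in>I - {i}. \<bar>f j\<bar>)" using sum_abs[of f "I - {i}"] by simp
    then show ?thesis using assms that by (simp add: sum_diff1)
  qed
  have "2 * (\<Sum>i\<in>I. f i ^ 2) = (\<Sum>i\<in>I. (2 * \<bar>f i\<bar>) * \<bar>f i\<bar>)"
    by (simp add: sum_distrib_left power2_eq_square mult.assoc flip: abs_mult)
  also have "\<dots> \<le> (\<Sum>i\<in>I. (\<Sum>i\<in>I. \<bar>f i\<bar>) * \<bar>f i\<bar>)"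
    using * by (intro sum_mono mult_right_mono) auto
  finally show ?thesis by (simp add: power2_eq_square sum_distrib_left)
qed

text \<open>
  The left-hand side is Jeffreys' divergence, the symmetrised relative entropy of \<open>p\<close> and \<open>q\<close>. The
  logarithmic mean inequality and Cauchy--Schwarz with the weights \<open>p i + q i\<close>, whose total is 2, bound
  it below by the squared \<open>\<ell>\<^sup>1\<close> distance, as in Pinsker's inequality. The factor 2 gained
  from \<open>p - q\<close> having zero sum becomes the threshold for \<open>\<beta>\<close> in the uniqueness of the equilibrium below.
\<close>

lemma jeffreys_divergence_gt:
  fixes p q :: "'i \<Rightarrow> real"
  assumes fin: "finite I" and pos: "\<And>i. i \<in> I \<Longrightarrow> p i > 0" "\<And>i. i \<in> I \<Longrightarrow> q i > 0"
    and one: "sum p I = 1" "sum q I = 1" and k: "k \<in> I" "p k \<noteq> q k"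
  shows "(\<Sum>i\<in>I. (ln (p i) - ln (q i)) * (p i - q i)) > 2 * (\<Sum>i\<in>I. (p i - q i) ^ 2)"
proof -
  let ?w = "\<lambda>i. sqrt (p i + q i)"
  have "(\<Sum>i\<in>I. \<bar>p i - q i\<bar>) = (\<Sum>i\<in>I. (\<bar>p i - q i\<bar> / ?w i) * ?w i)"
    using pos by (intro sum.cong refl) (simp add: less_imp_neq[symmetric] add_pos_pos)
  then have "(\<Sum>i\<in>I. \<bar>p i - q i\<bar>) ^ 2 \<le>
      (\<Sum>i\<in>I. (\<bar>p i - q i\<bar> / ?w i) ^ 2) * (\<Sum>i\<in>I. ?w i ^ 2)"
    using Cauchy_Schwarz_ineq_sum[of "\<lambda>i. \<bar>p i - q i\<bar> / ?w i" ?w I] by simp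
  also have "(\<Sum>i\<in>I. ?w i ^ 2) = 2"
    using one pos by (simp add: add_pos_pos less_imp_le sum.distrib cong: sum.cong)
  also have "(\<Sum>i\<in>I. (\<bar>p i - q i\<bar> / ?w i) ^ 2) * 2 = (\<Sum>i\<in>I. 2 * (p i - q i) ^ 2 / (p i + q i))"
    using pos unfolding sum_distrib_right
    by (intro sum.cong refl) (simp add: add_pos_pos less_imp_le power_divide)
  also have "\<dots> < (\<Sum>i\<in>I. (ln (p i) - ln (q i)) * (p i - q i))"
  proof (rule sum_strict_mono_ex1[OF fin])
    show "\<forall>i\<in>I. 2 * (p i - q i) ^ 2 / (p i + q i) \<le> (ln (p i) - ln (q i)) * (p i - q i)"
    proof
      fix i assume "i \<in> I"
      then show "2 * (p i - q i) ^ 2 / (p i + q i) \<le> (ln (p i) - ln (q i)) * (p i - q i)"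
        using ln_diff_mult_diff_gt[of "p i" "q i"] pos by (cases "p i = q i") auto
    qed
    show "\<exists>i\<in>I. 2 * (p i - q i) ^ 2 / (p i + q i) < (ln (p i) - ln (q i)) * (p i - q i)"
      using k ln_diff_mult_diff_gt pos by blast
  qed
  finally show ?thesis
    using two_sum_squares_le_square_sum_abs[OF fin, of "\<lambda>i. p i - q i"] one
    by (simp add: sum_subtractf)
qed

section \<open>The free energy and its dissipation\<close>

text \<open>
  Writing \<open>A\<close> for the linear map given by \<open>\<alpha>\<close>, the local field is \<open>A x\<close>, and
  \<^const>\<open>transition_prob\<close> is its softmax, taken separately for each walk.
\<close>

definition local_field ::
  "('d::finite \<Rightarrow> 'm::finite \<Rightarrow> 'm \<Rightarrow> real) \<Rightarrow> real ^ 'd ^ 'm \<Rightarrow> 'm \<Rightarrow> 'd \<Rightarrow> real" where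
  "local_field \<alpha> x i v = (\<Sum>j\<in>UNIV. \<alpha> v i j * x $ j $ v)"

definition partition_sum ::
  "('d::finite \<Rightarrow> 'm::finite \<Rightarrow> 'm \<Rightarrow> real) \<Rightarrow> real ^ 'd ^ 'm \<Rightarrow> 'm \<Rightarrow> real" where
  "partition_sum \<alpha> x i = (\<Sum>u\<in>UNIV. exp (local_field \<alpha> x i u))"

text \<open>
  With \<open>p\<close> for the transition probabilities at \<open>x\<close>, this is \<open>A (x - p)\<close>: the image under \<open>A\<close> of
  the amount by which \<open>x\<close> fails to be an equilibrium.
\<close>

definition defect ::
  "('d::finite \<Rightarrow> 'm::finite \<Rightarrow> 'm \<Rightarrow> real) \<Rightarrow> real ^ 'd ^ 'm \<Rightarrow> 'm \<Rightarrow> 'd \<Rightarrow> real" where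
  "defect \<alpha> x i v = local_field \<alpha> x i v - (\<Sum>j\<in>UNIV. \<alpha> v i j * transition_prob \<alpha> x j v)"

definition mean_defect ::
  "('d::finite \<Rightarrow> 'm::finite \<Rightarrow> 'm \<Rightarrow> real) \<Rightarrow> real ^ 'd ^ 'm \<Rightarrow> 'm \<Rightarrow> real" where
  "mean_defect \<alpha> x i = (\<Sum>u\<in>UNIV. transition_prob \<alpha> x i u * defect \<alpha> x i u)"

text \<open>
  This is the free energy \<open>p \<mapsto> \<Sum> p ln p - \<langle>p, A p\<rangle> / 2\<close>, taken at \<open>p = softmax (A x)\<close> instead of at
  \<open>x\<close>. At \<open>x\<close> it would also be a Lyapunov function, but its derivatives blow up at the boundary of
  the simplices; composed with the softmax it is smooth everywhere. The entropy is written
  as \<open>\<Sum> p ln p = \<langle>A x, p\<rangle> - \<Sum> ln Z\<close>, where \<open>Z\<close> are the partition sums.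
\<close>

definition energy ::
  "('d::finite \<Rightarrow> 'm::finite \<Rightarrow> 'm \<Rightarrow> real) \<Rightarrow> real ^ 'd ^ 'm \<Rightarrow> real" where
  "energy \<alpha> x =
     (\<Sum>i\<in>UNIV. \<Sum>v\<in>UNIV. local_field \<alpha> x i v * transition_prob \<alpha> x i v)
     - (\<Sum>i\<in>UNIV. \<Sum>v\<in>UNIV. \<Sum>j\<in>UNIV.
          \<alpha> v i j * (transition_prob \<alpha> x i v * transition_prob \<alpha> x j v)) / 2
     - (\<Sum>i\<in>UNIV. ln (partition_sum \<alpha> x i))"

definition energy_gradient ::
  "('d::finite \<Rightarrow> 'm::finite \<Rightarrow> 'm \<Rightarrow> real) \<Rightarrow> real ^ 'd ^ 'm \<Rightarrow> 'm \<Rightarrow> 'd \<Rightarrow> real" where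
  "energy_gradient \<alpha> x j v =
     (\<Sum>i\<in>UNIV. \<alpha> v i j * (transition_prob \<alpha> x i v * (defect \<alpha> x i v - mean_defect \<alpha> x i)))"

definition dissipation ::
  "('d::finite \<Rightarrow> 'm::finite \<Rightarrow> 'm \<Rightarrow> real) \<Rightarrow> real ^ 'd ^ 'm \<Rightarrow> real" where
  "dissipation \<alpha> x =
     (\<Sum>i\<in>UNIV. \<Sum>v\<in>UNIV. transition_prob \<alpha> x i v * (defect \<alpha> x i v - mean_defect \<alpha> x i) ^ 2)"

lemma partition_sum_pos: "partition_sum \<alpha> x i > 0"
  unfolding partition_sum_def by (rule sum_pos) auto

lemma transition_prob_eq:
  "transition_prob \<alpha> x i v = exp (local_field \<alpha> x i v) / partition_sum \<alpha> x i"
  by (simp add: transition_prob_def local_field_def partition_sum_def)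

lemma transition_prob_pos: "transition_prob \<alpha> x i v > 0"
  by (simp add: transition_prob_eq partition_sum_pos)

lemma sum_transition_prob: "(\<Sum>v\<in>UNIV. transition_prob \<alpha> x i v) = 1"
  using partition_sum_pos[of \<alpha> x i]
  by (simp add: transition_prob_eq partition_sum_def flip: sum_divide_distrib)

lemma transition_prob_le_1: "transition_prob \<alpha> x i v \<le> 1"
  using member_le_sum[of v UNIV "transition_prob \<alpha> x i"] sum_transition_prob[of \<alpha> x i]
  by (simp add: transition_prob_pos less_imp_le)

lemma ln_transition_prob:
  "ln (transition_prob \<alpha> x i v) = local_field \<alpha> x i v - ln (partition_sum \<alpha> x i)"
  using partition_sum_pos[of \<alpha> x i] by (simp add: transition_prob_eq ln_div)

lemma sum_transition_prob_centred:
  "(\<Sum>v\<in>UNIV. transition_prob \<alpha> x i v * (defect \<alpha> x i v - mean_defect \<alpha> x i)) = 0"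
  by (simp add: right_diff_distrib sum_subtractf mean_defect_def sum_transition_prob
      flip: sum_distrib_right)

lemma local_field_line:
  "local_field \<alpha> (x + t *\<^sub>R h) i v = local_field \<alpha> x i v + t * local_field \<alpha> h i v"
  by (simp add: local_field_def algebra_simps sum.distrib sum_distrib_left)

lemma DERIV_local_field:
  "((\<lambda>t. local_field \<alpha> (x + t *\<^sub>R h) i v) has_real_derivative local_field \<alpha> h i v) (at t)"
  unfolding local_field_line by (auto intro!: derivative_eq_intros)

lemma DERIV_partition_sum:
  "((\<lambda>t. partition_sum \<alpha> (x + t *\<^sub>R h) i) has_real_derivative
     (\<Sum>u\<in>UNIV. exp (local_field \<alpha> (x + t *\<^sub>R h) i u) * local_field \<alpha> h i u)) (at t)"
  unfolding partition_sum_def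
  by (intro DERIV_sum DERIV_fun_exp DERIV_local_field)

lemma DERIV_ln_partition_sum:
  "((\<lambda>t. ln (partition_sum \<alpha> (x + t *\<^sub>R h) i)) has_real_derivative
     (\<Sum>u\<in>UNIV. transition_prob \<alpha> (x + t *\<^sub>R h) i u * local_field \<alpha> h i u)) (at t)"
proof -
  have "((\<lambda>t. ln (partition_sum \<alpha> (x + t *\<^sub>R h) i)) has_real_derivative
     1 / partition_sum \<alpha> (x + t *\<^sub>R h) i *
     (\<Sum>u\<in>UNIV. exp (local_field \<alpha> (x + t *\<^sub>R h) i u) * local_field \<alpha> h i u)) (at t)"
    by (rule DERIV_chain2[OF DERIV_ln_divide DERIV_partition_sum]) (rule partition_sum_pos)
  then show ?thesis
    by (simp add: transition_prob_eq sum_distrib_left sum_divide_distrib)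
qed

text \<open>
  Taking logarithms first avoids the quotient rule: the derivative of \<open>ln p\<close> is the direction of
  the local field, centred by its mean under \<open>p\<close>.
\<close>

lemma DERIV_transition_prob:
  "((\<lambda>t. transition_prob \<alpha> (x + t *\<^sub>R h) i v) has_real_derivative
     transition_prob \<alpha> (x + t *\<^sub>R h) i v * (local_field \<alpha> h i v -
       (\<Sum>u\<in>UNIV. transition_prob \<alpha> (x + t *\<^sub>R h) i u * local_field \<alpha> h i u))) (at t)"
proof -
  have *: "transition_prob \<alpha> y i v = exp (local_field \<alpha> y i v - ln (partition_sum \<alpha> y i))" for y
    by (simp add: transition_prob_pos flip: ln_transition_prob)
  show ?thesis
    unfolding *[of "x + _ *\<^sub>R h"]
    by (intro DERIV_fun_exp DERIV_diff DERIV_local_field DERIV_ln_partition_sum)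
qed

text \<open>
  Along a line the contribution of the local field at fixed \<open>p\<close> cancels against the derivative of
  \<open>\<Sum> ln Z\<close>, because the mean of the field under \<open>p\<close> is the gradient of \<open>ln Z\<close>. Symmetry of \<open>A\<close> turns the rest
  into \<open>\<langle>dp, r\<rangle>\<close>, where \<open>r\<close> is the defect. Since \<open>dp\<close> is centred under \<open>p\<close>, this is a covariance
  of \<open>r\<close> with the field of the direction \<open>h\<close>, and so either of the two may be the centred factor; centring \<open>r\<close> and
  summing the coefficients of each component of \<open>h\<close> gives the gradient.
\<close>

lemma DERIV_energy:
  assumes sym: "\<And>v i j. \<alpha> v i j = \<alpha> v j i"
  shows "((\<lambda>t. energy \<alpha> (x + t *\<^sub>R h)) has_real_derivative
     (\<Sum>j\<in>UNIV. \<Sum>v\<in>UNIV. energy_gradient \<alpha> (x + t *\<^sub>R h) j v * h $ j $ v)) (at t)"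
proof -
  define p where "p i v = transition_prob \<alpha> (x + t *\<^sub>R h) i v" for i v
  define u where "u i v = local_field \<alpha> (x + t *\<^sub>R h) i v" for i v
  define r where "r i v = defect \<alpha> (x + t *\<^sub>R h) i v" for i v
  define m where "m i = mean_defect \<alpha> (x + t *\<^sub>R h) i" for i
  define k where "k i v = local_field \<alpha> h i v" for i v
  define dp where "dp i v = p i v * (k i v - (\<Sum>w\<in>UNIV. p i w * k i w))" for i v
  have D: "((\<lambda>t. energy \<alpha> (x + t *\<^sub>R h)) has_real_derivative
     (\<Sum>i\<in>UNIV. \<Sum>v\<in>UNIV. k i v * p i v + dp i v * u i v)
     - (\<Sum>i\<in>UNIV. \<Sum>v\<in>UNIV. \<Sum>j\<in>UNIV. \<alpha> v i j * (dp i v * p j v + dp j v * p i v)) / 2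
     - (\<Sum>i\<in>UNIV. \<Sum>v\<in>UNIV. p i v * k i v)) (at t)"
    unfolding energy_def p_def u_def k_def dp_def
    by (intro DERIV_diff DERIV_sum DERIV_cdivide DERIV_cmult DERIV_mult
        DERIV_local_field DERIV_transition_prob DERIV_ln_partition_sum)
  have swap: "(\<Sum>i\<in>UNIV. \<Sum>v\<in>UNIV. \<Sum>j\<in>UNIV. \<alpha> v i j * (dp j v * p i v))
      = (\<Sum>i\<in>UNIV. \<Sum>v\<in>UNIV. \<Sum>j\<in>UNIV. \<alpha> v i j * (dp i v * p j v))"
  proof -
    have "(\<Sum>i\<in>UNIV. \<Sum>v\<in>UNIV. \<Sum>j\<in>UNIV. \<alpha> v i j * (dp j v * p i v))
      = (\<Sum>v\<in>UNIV. \<Sum>j\<in>UNIV. \<Sum>i\<in>UNIV. \<alpha> v i j * (dp j v * p i v))"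
      by (subst sum.swap) (intro sum.cong refl sum.swap)
    also have "\<dots> = (\<Sum>j\<in>UNIV. \<Sum>v\<in>UNIV. \<Sum>i\<in>UNIV. \<alpha> v j i * (dp j v * p i v))"
      by (subst sum.swap) (simp add: sym)
    finally show ?thesis .
  qed
  have "(\<Sum>i\<in>UNIV. \<Sum>v\<in>UNIV. k i v * p i v + dp i v * u i v)
     - (\<Sum>i\<in>UNIV. \<Sum>v\<in>UNIV. \<Sum>j\<in>UNIV. \<alpha> v i j * (dp i v * p j v + dp j v * p i v)) / 2
     - (\<Sum>i\<in>UNIV. \<Sum>v\<in>UNIV. p i v * k i v)
     = (\<Sum>i\<in>UNIV. \<Sum>v\<in>UNIV. dp i v * u i v)
       - (\<Sum>i\<in>UNIV. \<Sum>v\<in>UNIV. \<Sum>j\<in>UNIV. \<alpha> v i j * (dp i v * p j v))"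
    by (simp add: distrib_left sum.distrib swap mult.commute[of "k _ _"])
  also have "\<dots> = (\<Sum>i\<in>UNIV. \<Sum>v\<in>UNIV. dp i v * r i v)"
    by (simp add: r_def defect_def u_def p_def right_diff_distrib sum_subtractf sum_distrib_left
        ac_simps)
  also have "\<dots> = (\<Sum>i\<in>UNIV. \<Sum>v\<in>UNIV. p i v * (r i v - m i) * k i v)"
  proof (rule sum.cong[OF refl])
    fix i
    define c where "c = (\<Sum>w\<in>UNIV. p i w * k i w)"
    have m: "m i = (\<Sum>v\<in>UNIV. p i v * r i v)" by (simp add: m_def mean_defect_def p_def r_def)
    have "(\<Sum>v\<in>UNIV. dp i v * r i v) = (\<Sum>v\<in>UNIV. p i v * r i v * k i v - c * (p i v * r i v))"
      unfolding dp_def c_def[symmetric]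
      by (simp add: right_diff_distrib left_diff_distrib ac_simps)
    also have "\<dots> = (\<Sum>v\<in>UNIV. p i v * r i v * k i v) - c * m i"
      by (simp add: sum_subtractf m sum_distrib_left)
    also have "\<dots> = (\<Sum>v\<in>UNIV. p i v * r i v * k i v - m i * (p i v * k i v))"
      by (simp add: sum_subtractf c_def flip: sum_distrib_left)
    also have "\<dots> = (\<Sum>v\<in>UNIV. p i v * (r i v - m i) * k i v)"
      by (intro sum.cong refl) (simp add: algebra_simps)
    finally show "(\<Sum>v\<in>UNIV. dp i v * r i v) = \<dots>" .
  qed
  also have "\<dots> = (\<Sum>i\<in>UNIV. \<Sum>v\<in>UNIV. \<Sum>j\<in>UNIV. \<alpha> v i j * (p i v * (r i v - m i)) * h $ j $ v)"
    by (simp add: k_def local_field_def sum_distrib_left ac_simps)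
  also have "\<dots> = (\<Sum>v\<in>UNIV. \<Sum>j\<in>UNIV. \<Sum>i\<in>UNIV. \<alpha> v i j * (p i v * (r i v - m i)) * h $ j $ v)"
    by (subst sum.swap) (intro sum.cong refl sum.swap)
  also have "\<dots> = (\<Sum>j\<in>UNIV. \<Sum>v\<in>UNIV. energy_gradient \<alpha> (x + t *\<^sub>R h) j v * h $ j $ v)"
    by (subst sum.swap) (simp add: energy_gradient_def p_def r_def m_def sum_distrib_right)
  finally show ?thesis using D by simp
qed

text \<open>
  In the direction \<open>p - x\<close> of the mean motion the field is \<open>A (p - x) = - r\<close>. The covariance in
  the derivative of the energy then becomes minus the variance of \<open>r\<close>.
\<close>

lemma sum_energy_gradient_drift:
  "(\<Sum>j\<in>UNIV. \<Sum>v\<in>UNIV. energy_gradient \<alpha> x j v * (transition_prob \<alpha> x j v - x $ j $ v))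
     = - dissipation \<alpha> x"
proof -
  define c where "c i v = transition_prob \<alpha> x i v * (defect \<alpha> x i v - mean_defect \<alpha> x i)" for i v
  have "(\<Sum>j\<in>UNIV. \<Sum>v\<in>UNIV. energy_gradient \<alpha> x j v * (transition_prob \<alpha> x j v - x $ j $ v))
     = (\<Sum>v\<in>UNIV. \<Sum>j\<in>UNIV. \<Sum>i\<in>UNIV. c i v * (\<alpha> v i j * (transition_prob \<alpha> x j v - x $ j $ v)))"
    unfolding energy_gradient_def sum_distrib_right c_def
    by (subst sum.swap) (simp add: ac_simps)
  also have "\<dots> = (\<Sum>v\<in>UNIV. \<Sum>i\<in>UNIV. \<Sum>j\<in>UNIV.
      c i v * (\<alpha> v i j * (transition_prob \<alpha> x j v - x $ j $ v)))"
    by (intro sum.cong refl sum.swap)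
  also have "\<dots> = (\<Sum>v\<in>UNIV. \<Sum>i\<in>UNIV. c i v * - defect \<alpha> x i v)"
    by (simp add: defect_def local_field_def right_diff_distrib sum_subtractf sum_distrib_left)
  also have "\<dots> = (\<Sum>i\<in>UNIV. \<Sum>v\<in>UNIV. c i v * - defect \<alpha> x i v)"
    by (rule sum.swap)
  also have "\<dots> = (\<Sum>i\<in>UNIV. - (\<Sum>v\<in>UNIV. transition_prob \<alpha> x i v *
      (defect \<alpha> x i v - mean_defect \<alpha> x i) ^ 2))"
  proof (rule sum.cong[OF refl])
    fix i
    have "(\<Sum>v\<in>UNIV. c i v * - defect \<alpha> x i v)
        = (\<Sum>v\<in>UNIV. - (transition_prob \<alpha> x i v * (defect \<alpha> x i v - mean_defect \<alpha> x i) ^ 2)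
            - mean_defect \<alpha> x i * c i v)"
      by (intro sum.cong refl) (simp add: c_def power2_eq_square algebra_simps)
    also have "\<dots> = - (\<Sum>v\<in>UNIV. transition_prob \<alpha> x i v *
        (defect \<alpha> x i v - mean_defect \<alpha> x i) ^ 2)"
      using sum_transition_prob_centred[of \<alpha> x i]
      by (simp add: sum_subtractf sum_negf c_def flip: sum_distrib_left)
    finally show "(\<Sum>v\<in>UNIV. c i v * - defect \<alpha> x i v) = \<dots>" .
  qed
  finally show ?thesis by (simp add: dissipation_def sum_negf)
qed

lemma dissipation_nonneg: "dissipation \<alpha> x \<ge> 0"
  unfolding dissipation_def
  by (intro sum_nonneg mult_nonneg_nonneg) (simp_all add: transition_prob_pos less_imp_le)

section \<open>Quadratic expansion of the energy on the simplices\<close>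

definition simplices :: "(real ^ 'd::finite ^ 'm::finite) set" where
  "simplices = {x. (\<forall>i v. 0 \<le> x $ i $ v) \<and> (\<forall>i. (\<Sum>v\<in>UNIV. x $ i $ v) = 1)}"

lemma simplices_component_le_1: "x \<in> simplices \<Longrightarrow> x $ i $ v \<le> 1"
  using member_le_sum[of v UNIV "\<lambda>v. x $ i $ v"] by (auto simp: simplices_def)

lemma compact_simplices: "compact (simplices :: (real ^ 'd::finite ^ 'm::finite) set)"
proof -
  have "bounded (simplices :: (real ^ 'd ^ 'm) set)"
  proof (rule boundedI)
    fix x :: "real ^ 'd ^ 'm" assume x: "x \<in> simplices"
    have "norm x \<le> (\<Sum>i\<in>UNIV. norm (x $ i))"
      unfolding norm_vec_def by (rule L2_set_le_sum) simp
    also have "\<dots> \<le> (\<Sum>i\<in>UNIV. \<Sum>v\<in>UNIV. \<bar>x $ i $ v\<bar>)" by (intro sum_mono norm_le_l1_cart)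
    also have "\<dots> = (\<Sum>i\<in>(UNIV::'m set). 1)"
      using x by (intro sum.cong refl) (simp add: simplices_def)
    finally show "norm x \<le> real CARD('m)" by simp
  qed
  moreover have "closed (simplices :: (real ^ 'd ^ 'm) set)"
    unfolding simplices_def
    by (intro closed_Collect_conj closed_Collect_all closed_Collect_le closed_Collect_eq
        continuous_intros)
  ultimately show ?thesis by (simp add: compact_eq_bounded_closed)
qed

lemma convex_simplices: "convex simplices"
proof (rule convexI)
  fix x y :: "real ^ 'd::finite ^ 'm::finite" and a b :: real
  assume "x \<in> simplices" "y \<in> simplices" "0 \<le> a" "0 \<le> b" "a + b = 1"
  then show "a *\<^sub>R x + b *\<^sub>R y \<in> simplices"
    by (simp add: simplices_def sum.distrib flip: sum_distrib_left)
qed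

lemma lipschitzian_component:
  "lipschitzian K (\<lambda>x :: real ^ 'd::finite ^ 'm::finite. x $ i $ v)"
proof (rule lipschitzianI[where L = 1])
  fix x y :: "real ^ 'd ^ 'm"
  have "\<bar>x $ i $ v - y $ i $ v\<bar> \<le> norm ((x - y) $ i)"
    using component_le_norm_cart[of "(x - y) $ i" v] by simp
  also have "\<dots> \<le> norm (x - y)" by (rule Finite_Cartesian_Product.norm_nth_le)
  finally show "\<bar>x $ i $ v - y $ i $ v\<bar> \<le> 1 * dist x y" by (simp add: dist_norm)
qed

lemma lipschitzian_local_field:
  "compact K \<Longrightarrow> lipschitzian K (\<lambda>x. local_field \<alpha> x i v)"
  unfolding local_field_def
  by (intro lipschitzian_sum lipschitzian_mult lipschitzian_const lipschitzian_component)

lemma lipschitzian_partition_sum: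
  "compact K \<Longrightarrow> lipschitzian K (\<lambda>x. partition_sum \<alpha> x i)"
  unfolding partition_sum_def
  by (intro lipschitzian_sum lipschitzian_exp lipschitzian_local_field)

lemma lipschitzian_transition_prob:
  "compact K \<Longrightarrow> lipschitzian K (\<lambda>x. transition_prob \<alpha> x i v)"
  unfolding transition_prob_eq
  by (intro lipschitzian_divide lipschitzian_exp lipschitzian_local_field
      lipschitzian_partition_sum partition_sum_pos)

lemma lipschitzian_defect: "compact K \<Longrightarrow> lipschitzian K (\<lambda>x. defect \<alpha> x i v)"
  unfolding defect_def
  by (intro lipschitzian_diff lipschitzian_sum lipschitzian_mult lipschitzian_const
      lipschitzian_local_field lipschitzian_transition_prob)

lemma lipschitzian_mean_defect: "compact K \<Longrightarrow> lipschitzian K (\<lambda>x. mean_defect \<alpha> x i)"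
  unfolding mean_defect_def
  by (intro lipschitzian_sum lipschitzian_mult lipschitzian_transition_prob lipschitzian_defect)

lemma lipschitzian_energy: "compact K \<Longrightarrow> lipschitzian K (energy \<alpha>)"
  unfolding energy_def[abs_def]
  by (intro lipschitzian_diff lipschitzian_sum lipschitzian_mult lipschitzian_divide
      lipschitzian_ln lipschitzian_const lipschitzian_local_field lipschitzian_transition_prob
      lipschitzian_partition_sum partition_sum_pos) simp_all

lemma lipschitzian_energy_gradient:
  "compact K \<Longrightarrow> lipschitzian K (\<lambda>x. energy_gradient \<alpha> x j v)"
  unfolding energy_gradient_def
  by (intro lipschitzian_sum lipschitzian_mult lipschitzian_diff lipschitzian_const
      lipschitzian_transition_prob lipschitzian_defect lipschitzian_mean_defect)

lemma lipschitzian_dissipation: "compact K \<Longrightarrow> lipschitzian K (dissipation \<alpha>)"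
  unfolding dissipation_def[abs_def] power2_eq_square
  by (intro lipschitzian_sum lipschitzian_mult lipschitzian_diff
      lipschitzian_transition_prob lipschitzian_defect lipschitzian_mean_defect)

text \<open>
  The gradient is Lipschitz on the compact convex set of simplices, so the mean value theorem on the
  segment from \<open>x\<close> to \<open>y\<close> leaves an error of second order.
\<close>

lemma energy_quadratic_bound:
  fixes \<alpha> :: "'d::finite \<Rightarrow> 'm::finite \<Rightarrow> 'm \<Rightarrow> real"
  assumes sym: "\<And>v i j. \<alpha> v i j = \<alpha> v j i"
  obtains C where "C \<ge> 0"
    "\<And>x y. x \<in> simplices \<Longrightarrow> y \<in> simplices \<Longrightarrow>
       energy \<alpha> y \<le> energy \<alpha> x +
         (\<Sum>j\<in>UNIV. \<Sum>v\<in>UNIV. energy_gradient \<alpha> x j v * (y - x) $ j $ v) + C * norm (y - x) ^ 2"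
proof -
  have "\<exists>L. L \<ge> 0 \<and> (\<forall>x\<in>simplices. \<forall>y\<in>simplices.
      \<bar>energy_gradient \<alpha> x j v - energy_gradient \<alpha> y j v\<bar> \<le> L * dist x y)" for j v
    using lipschitzian_energy_gradient[OF compact_simplices, of \<alpha> j v] lipschitzianE by metis
  then obtain L where L0: "\<And>j v. L j v \<ge> 0"
    and L: "\<And>j v x y. x \<in> simplices \<Longrightarrow> y \<in> simplices \<Longrightarrow>
      \<bar>energy_gradient \<alpha> x j v - energy_gradient \<alpha> y j v\<bar> \<le> L j v * dist x y"
    by metis
  show ?thesis
  proof (rule that[of "\<Sum>j\<in>UNIV. \<Sum>v\<in>UNIV. L j v"])
    show "(\<Sum>j\<in>UNIV. \<Sum>v\<in>UNIV. L j v) \<ge> 0" by (intro sum_nonneg L0)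
    fix x y :: "real ^ 'd ^ 'm" assume x: "x \<in> simplices" and y: "y \<in> simplices"
    define h where "h = y - x"
    have "\<exists>s>0. s < 1 \<and> energy \<alpha> (x + 1 *\<^sub>R h) - energy \<alpha> (x + 0 *\<^sub>R h)
        = (1 - 0) * (\<Sum>j\<in>UNIV. \<Sum>v\<in>UNIV. energy_gradient \<alpha> (x + s *\<^sub>R h) j v * h $ j $ v)"
      by (rule MVT2[OF zero_less_one DERIV_energy[OF sym]])
    then obtain s where s: "0 < s" "s < 1"
      and mvt: "energy \<alpha> (x + 1 *\<^sub>R h) - energy \<alpha> (x + 0 *\<^sub>R h)
        = (1 - 0) * (\<Sum>j\<in>UNIV. \<Sum>v\<in>UNIV. energy_gradient \<alpha> (x + s *\<^sub>R h) j v * h $ j $ v)"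
      by blast
    define z where "z = x + s *\<^sub>R h"
    have "z = (1 - s) *\<^sub>R x + s *\<^sub>R y" by (simp add: z_def h_def algebra_simps)
    then have z: "z \<in> simplices" using convexD[OF convex_simplices x y, of "1 - s" s] s by simp
    have zx: "dist z x \<le> norm h"
      using s by (simp add: z_def dist_norm mult_left_le_one_le)
    have comp: "\<bar>h $ j $ v\<bar> \<le> norm h" for j v
      using component_le_norm_cart[of "h $ j" v] Finite_Cartesian_Product.norm_nth_le[of h j]
      by linarith
    have "(\<Sum>j\<in>UNIV. \<Sum>v\<in>UNIV. energy_gradient \<alpha> z j v * h $ j $ v)
        \<le> (\<Sum>j\<in>UNIV. \<Sum>v\<in>UNIV. energy_gradient \<alpha> x j v * h $ j $ v + L j v * norm h ^ 2)"
    proof (intro sum_mono)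
      fix j v
      have "(energy_gradient \<alpha> z j v - energy_gradient \<alpha> x j v) * h $ j $ v
          \<le> \<bar>energy_gradient \<alpha> z j v - energy_gradient \<alpha> x j v\<bar> * \<bar>h $ j $ v\<bar>"
        by (metis abs_ge_self abs_mult)
      also have "\<dots> \<le> (L j v * norm h) * norm h"
        using L0
        by (intro mult_mono comp order_trans[OF L[OF z x] mult_left_mono[OF zx L0]]) simp_all
      finally show "energy_gradient \<alpha> z j v * h $ j $ v
          \<le> energy_gradient \<alpha> x j v * h $ j $ v + L j v * norm h ^ 2"
        by (simp add: algebra_simps power2_eq_square)
    qed
    also have "\<dots> = (\<Sum>j\<in>UNIV. \<Sum>v\<in>UNIV. energy_gradient \<alpha> x j v * h $ j $ v)
        + (\<Sum>j\<in>UNIV. \<Sum>v\<in>UNIV. L j v) * norm h ^ 2"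
      by (simp add: sum.distrib sum_distrib_right)
    finally show "energy \<alpha> y \<le> energy \<alpha> x +
         (\<Sum>j\<in>UNIV. \<Sum>v\<in>UNIV. energy_gradient \<alpha> x j v * (y - x) $ j $ v)
         + (\<Sum>j\<in>UNIV. \<Sum>v\<in>UNIV. L j v) * norm (y - x) ^ 2"
      using mvt by (simp add: z_def h_def)
  qed
qed

section \<open>Equilibria of repelling walks\<close>

text \<open>
  The equation says \<open>ln p\<^sub>i = c\<^sub>i - \<beta> * s + \<beta> * p\<^sub>i\<close> with \<open>s\<close> the sum of all \<open>p\<^sub>j\<close>. Pair it with \<open>p\<^sub>i - q\<close>, where
  \<open>q\<close> is the uniform distribution, and sum over \<open>i\<close>. Constants disappear because \<open>p\<^sub>i - q\<close> has zero sum, and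
  repulsion contributes minus \<open>\<beta>\<close> times a square, so the total Jeffreys divergence from \<open>q\<close> is at
  most \<open>\<beta>\<close> times the total squared distance from \<open>q\<close>. For \<open>\<beta> \<le> 2\<close> this contradicts
  \<open>jeffreys_divergence_gt\<close> unless every \<open>p\<^sub>i\<close> is uniform; that inequality is strict, which allows \<open>\<beta> = 2\<close>.
\<close>

lemma repelling_equilibrium_uniform:
  fixes p :: "'m::finite \<Rightarrow> 'd::finite \<Rightarrow> real" and c :: "'m \<Rightarrow> real"
  assumes \<beta>: "0 \<le> \<beta>" "\<beta> \<le> 2"
    and pos: "\<And>i v. p i v > 0" and one: "\<And>i. (\<Sum>v\<in>UNIV. p i v) = 1"
    and eq: "\<And>i v. ln (p i v) = c i - \<beta> * ((\<Sum>j\<in>UNIV. p j v) - p i v)"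
  shows "p i v = 1 / real CARD('d)"
proof -
  define q where "q = 1 / real CARD('d)"
  define s where "s v = (\<Sum>j\<in>UNIV. p j v)" for v
  have q: "q > 0" "(\<Sum>v\<in>(UNIV::'d set). q) = 1" by (simp_all add: q_def)
  define J where "J i = (\<Sum>v\<in>UNIV. (ln (p i v) - ln q) * (p i v - q))" for i
  define Q where "Q i = (\<Sum>v\<in>UNIV. (p i v - q) ^ 2)" for i
  have centred: "(\<Sum>v\<in>UNIV. p i v - q) = 0" for i
    using one[of i] q(2) by (simp add: sum_subtractf)
  have J: "J i = \<beta> * Q i - \<beta> * (\<Sum>v\<in>UNIV. s v * (p i v - q))" for i
  proof -
    have "J i = (\<Sum>v\<in>UNIV. (c i - ln q + \<beta> * q) * (p i v - q) + \<beta> * (p i v - q) ^ 2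
        - \<beta> * (s v * (p i v - q)))"
      unfolding J_def eq s_def[symmetric]
      by (intro sum.cong refl) (simp add: algebra_simps power2_eq_square)
    also have "\<dots> = \<beta> * Q i - \<beta> * (\<Sum>v\<in>UNIV. s v * (p i v - q))"
      using centred[of i] by (simp add: sum_subtractf sum.distrib Q_def flip: sum_distrib_left)
    finally show ?thesis .
  qed
  have "(\<Sum>i\<in>UNIV. \<Sum>v\<in>UNIV. s v * (p i v - q)) = (\<Sum>v\<in>UNIV. s v * (s v - CARD('m) * q))"
    by (subst sum.swap) (simp add: s_def sum_subtractf flip: sum_distrib_left)
  also have "\<dots> = (\<Sum>v\<in>UNIV. (s v - CARD('m) * q) ^ 2 + CARD('m) * q * (s v - CARD('m) * q))"
    by (intro sum.cong refl) (simp add: algebra_simps power2_eq_square)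
  also have "\<dots> = (\<Sum>v\<in>UNIV. (s v - CARD('m) * q) ^ 2)"
  proof -
    have "(\<Sum>v\<in>UNIV. s v) = (\<Sum>i\<in>UNIV. \<Sum>v\<in>UNIV. p i v)"
      unfolding s_def by (rule sum.swap)
    then have "(\<Sum>v\<in>UNIV. s v - CARD('m) * q) = 0"
      by (simp add: sum_subtractf one q_def)
    then show ?thesis by (simp add: sum.distrib flip: sum_distrib_left)
  qed
  finally have "(\<Sum>i\<in>UNIV. \<Sum>v\<in>UNIV. s v * (p i v - q)) \<ge> 0" by (simp add: sum_nonneg)
  then have "(\<Sum>i\<in>UNIV. J i) \<le> \<beta> * (\<Sum>i\<in>UNIV. Q i)"
    using \<beta> by (simp add: J sum_subtractf flip: sum_distrib_left)
  also have "\<dots> \<le> 2 * (\<Sum>i\<in>UNIV. Q i)"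
    using \<beta> by (intro mult_right_mono) (auto simp: Q_def intro!: sum_nonneg)
  finally have le: "(\<Sum>i\<in>UNIV. J i) \<le> (\<Sum>i\<in>UNIV. 2 * Q i)" by (simp add: sum_distrib_left)
  have gt: "2 * Q i < J i" if "p i v \<noteq> q" for i v
    unfolding Q_def J_def
    by (rule jeffreys_divergence_gt[where k = v]) (use pos q one that in \<open>simp_all\<close>)
  have ge: "2 * Q i \<le> J i" for i
  proof (cases "\<forall>v. p i v = q")
    case True then show ?thesis by (simp add: Q_def J_def)
  next
    case False then show ?thesis using gt less_imp_le by blast
  qed
  have "p i v = q"
  proof (rule ccontr)
    assume "p i v \<noteq> q"
    then have "(\<Sum>i\<in>UNIV. 2 * Q i) < (\<Sum>i\<in>UNIV. J i)"
      using gt ge by (intro sum_strict_mono_ex1) auto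
    then show False using le by simp
  qed
  then show ?thesis by (simp add: q_def)
qed

lemma dissipation_eq_0_imp:
  assumes "dissipation \<alpha> x = 0"
  shows "defect \<alpha> x i v = mean_defect \<alpha> x i"
proof -
  have nn: "transition_prob \<alpha> x i v * (defect \<alpha> x i v - mean_defect \<alpha> x i) ^ 2 \<ge> 0" for i v
    by (intro mult_nonneg_nonneg) (simp_all add: transition_prob_pos less_imp_le)
  have "\<forall>i\<in>UNIV. (\<Sum>v\<in>UNIV. transition_prob \<alpha> x i v * (defect \<alpha> x i v - mean_defect \<alpha> x i) ^ 2) = 0"
    using assms unfolding dissipation_def
    by (subst (asm) sum_nonneg_eq_0_iff) (auto intro!: sum_nonneg nn)
  then have "(\<Sum>v\<in>UNIV. transition_prob \<alpha> x i v * (defect \<alpha> x i v - mean_defect \<alpha> x i) ^ 2) = 0"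
    by blast
  then have "\<forall>v\<in>UNIV. transition_prob \<alpha> x i v * (defect \<alpha> x i v - mean_defect \<alpha> x i) ^ 2 = 0"
    by (subst (asm) sum_nonneg_eq_0_iff) (simp_all add: nn)
  then have "transition_prob \<alpha> x i v * (defect \<alpha> x i v - mean_defect \<alpha> x i) ^ 2 = 0" by blast
  then show ?thesis using transition_prob_pos[of \<alpha> x i v] by simp
qed

text \<open>
  Zero dissipation makes the defect constant in \<open>v\<close>. As the softmax ignores such constants, \<open>p\<close> is an
  equilibrium, hence uniform by \<open>repelling_equilibrium_uniform\<close>. Then the local field of \<open>x\<close> is constant
  in \<open>v\<close> as well, so for each walk the occupations of the other walks add up to the same value at
  every vertex; with at least two walks these equations determine \<open>x\<close>.
\<close>

lemma repelling_dissipation_eq_0_imp: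
  fixes \<alpha> :: "'d::finite \<Rightarrow> 'm::finite \<Rightarrow> 'm \<Rightarrow> real" and x :: "real ^ 'd ^ 'm"
  assumes \<beta>: "0 < \<beta>" "\<beta> \<le> 2" and m: "CARD('m) \<ge> 2"
    and \<alpha>: "\<And>v i j. \<alpha> v i j = - \<beta> * (1 - of_bool (i = j))"
    and x: "x \<in> simplices" and D: "dissipation \<alpha> x = 0"
  shows "x = (\<chi> i v. 1 / real CARD('d))"
proof -
  define d where "d = real CARD('d)"
  define m' where "m' = real CARD('m)"
  have d: "d > 0" and m': "m' > 1" using m by (simp_all add: d_def m'_def)
  have sum_\<alpha>: "(\<Sum>j\<in>UNIV. \<alpha> v i j * y j) = - \<beta> * ((\<Sum>j\<in>UNIV. y j) - y i)"
    for v i and y :: "'m \<Rightarrow> real"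
  proof -
    have "(\<Sum>j\<in>UNIV. \<alpha> v i j * y j) = (\<Sum>j\<in>UNIV. - \<beta> * y j + \<beta> * (if i = j then y j else 0))"
      by (intro sum.cong refl) (simp add: \<alpha> algebra_simps)
    also have "\<dots> = - \<beta> * (\<Sum>j\<in>UNIV. y j) + \<beta> * (\<Sum>j\<in>UNIV. if i = j then y j else 0)"
      unfolding sum.distrib sum_distrib_left ..
    finally show ?thesis by (simp add: right_diff_distrib)
  qed
  have p: "transition_prob \<alpha> x i v = 1 / d" for i v
    unfolding d_def
  proof (rule repelling_equilibrium_uniform[where \<beta> = \<beta>
        and c = "\<lambda>i. mean_defect \<alpha> x i - ln (partition_sum \<alpha> x i)"])
    fix i v
    have "local_field \<alpha> x i v = mean_defect \<alpha> x i + (\<Sum>j\<in>UNIV. \<alpha> v i j * transition_prob \<alpha> x j v)"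
      using dissipation_eq_0_imp[OF D, of i v] by (simp add: defect_def)
    then show "ln (transition_prob \<alpha> x i v) = mean_defect \<alpha> x i - ln (partition_sum \<alpha> x i)
        - \<beta> * ((\<Sum>j\<in>UNIV. transition_prob \<alpha> x j v) - transition_prob \<alpha> x i v)"
      by (simp add: ln_transition_prob sum_\<alpha>)
  qed (use \<beta> in \<open>simp_all add: transition_prob_pos sum_transition_prob\<close>)
  define S where "S v = (\<Sum>j\<in>UNIV. x $ j $ v)" for v
  have sumS: "(\<Sum>v\<in>UNIV. S v) = m'"
  proof -
    have "(\<Sum>v\<in>UNIV. S v) = (\<Sum>j\<in>UNIV. \<Sum>v\<in>UNIV. x $ j $ v)" unfolding S_def by (rule sum.swap)
    then show ?thesis using x by (simp add: simplices_def m'_def)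
  qed
  have others: "S v - x $ i $ v = (m' - 1) / d" for i v
  proof -
    define k where "k = (ln (1 / d) + ln (partition_sum \<alpha> x i)) / - \<beta>"
    have k: "S v - x $ i $ v = k" for v
    proof -
      have "local_field \<alpha> x i v = - \<beta> * (S v - x $ i $ v)"
        by (simp add: local_field_def sum_\<alpha> S_def)
      then show ?thesis using ln_transition_prob[of \<alpha> x i v] \<beta>(1) by (simp add: p k_def field_simps)
    qed
    have "(\<Sum>v\<in>UNIV. S v - x $ i $ v) = m' - 1"
      using x sumS by (simp add: sum_subtractf simplices_def)
    then have "d * k = m' - 1" unfolding k by (simp add: d_def)
    then show ?thesis using k d by (simp add: field_simps)
  qed
  have "x $ i $ v = 1 / d" for i v
  proof -
    have "(\<Sum>j\<in>UNIV. S v - x $ j $ v) = m' * ((m' - 1) / d)"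
      unfolding others by (simp add: m'_def)
    then have "(m' - 1) * S v = (m' - 1) * (m' / d)"
      by (simp add: sum_subtractf m'_def S_def algebra_simps)
    moreover have "m' - 1 \<noteq> 0" using m' by simp
    ultimately have "S v = m' / d" by (metis mult_left_cancel)
    then show ?thesis using others[of v i] d by (simp add: field_simps)
  qed
  then show ?thesis by (simp add: vec_eq_iff d_def)
qed

section \<open>Decay of the dissipation along the process\<close>

lemma occupation_measure_in_simplices:
  assumes "n \<ge> 1"
  shows "occupation_measure W n \<omega> \<in> (simplices :: (real ^ 'd::finite ^ 'm::finite) set)"
  unfolding simplices_def
proof (intro CollectI conjI allI)
  fix i :: 'm
  have "(\<Sum>v\<in>(UNIV::'d set). 1 + (\<Sum>k=1..n. of_bool (W k \<omega> i = v))) = real CARD('d) + real n"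
    by (subst sum.distrib, subst sum.swap) (simp add: of_bool_def)
  moreover have "real CARD('d) + real n > 0" by (simp add: add_pos_nonneg)
  ultimately show "(\<Sum>v\<in>UNIV. occupation_measure W n \<omega> $ i $ v) = 1"
    using assms by (simp add: occupation_measure_def flip: sum_divide_distrib)
next
  fix i :: 'm and v :: 'd
  show "0 \<le> occupation_measure W n \<omega> $ i $ v"
    using assms by (auto simp: occupation_measure_def
        intro!: divide_nonneg_nonneg add_nonneg_nonneg sum_nonneg)
qed

lemma occupation_measure_step:
  fixes W :: "nat \<Rightarrow> 'a \<Rightarrow> 'm::finite \<Rightarrow> 'd::finite"
  assumes "n \<ge> 1"
  shows "(occupation_measure W (Suc n) \<omega> - occupation_measure W n \<omega>) $ i $ v =
    (of_bool (W (Suc n) \<omega> i = v) - occupation_measure W n \<omega> $ i $ v)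
      / (real CARD('d) + real n + 1)"
proof -
  have "real CARD('d) + real n > 0" by (simp add: add_pos_nonneg)
  then show ?thesis
    using assms by (simp add: occupation_measure_def field_simps)
qed

lemma norm_occupation_measure_step:
  fixes W :: "nat \<Rightarrow> 'a \<Rightarrow> 'm::finite \<Rightarrow> 'd::finite"
  assumes "n \<ge> 1"
  shows "norm (occupation_measure W (Suc n) \<omega> - occupation_measure W n \<omega>)
    \<le> real CARD('m) * real CARD('d) * (1 / (real CARD('d) + real n + 1))"
proof -
  let ?h = "occupation_measure W (Suc n) \<omega> - occupation_measure W n \<omega>"
  have comp: "\<bar>?h $ i $ v\<bar> \<le> 1 / (real CARD('d) + real n + 1)" for i v
  proof -
    have "0 \<le> occupation_measure W n \<omega> $ i $ v" "occupation_measure W n \<omega> $ i $ v \<le> 1"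
      using occupation_measure_in_simplices[OF assms, of W \<omega>] simplices_component_le_1
      by (auto simp: simplices_def)
    then show ?thesis
      unfolding occupation_measure_step[OF assms] abs_divide by (intro divide_mono) auto
  qed
  have "norm ?h \<le> (\<Sum>i\<in>UNIV. norm (?h $ i))" unfolding norm_vec_def by (rule L2_set_le_sum) simp
  also have "\<dots> \<le> (\<Sum>i\<in>UNIV. \<Sum>v\<in>UNIV. \<bar>?h $ i $ v\<bar>)" by (intro sum_mono norm_le_l1_cart)
  also have "\<dots> \<le> (\<Sum>i\<in>(UNIV::'m set). \<Sum>v\<in>(UNIV::'d set). 1 / (real CARD('d) + real n + 1))"
    by (intro sum_mono comp)
  finally show ?thesis by simp
qed

text \<open>
  By monotone convergence the sum of the series has a finite expectation, hence is finite almost surely.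
\<close>

lemma AE_summable_of_summable_expectation:
  fixes f :: "nat \<Rightarrow> 'a \<Rightarrow> real"
  assumes int: "\<And>n. integrable M (f n)" and nn: "\<And>n \<omega>. f n \<omega> \<ge> 0"
    and sum: "summable (\<lambda>n. \<integral>\<omega>. f n \<omega> \<partial>M)"
  shows "AE \<omega> in M. summable (\<lambda>n. f n \<omega>)"
proof -
  have [measurable]: "f n \<in> borel_measurable M" for n using int by auto
  have "(\<integral>\<^sup>+\<omega>. (\<Sum>n. ennreal (f n \<omega>)) \<partial>M) = (\<Sum>n. \<integral>\<^sup>+\<omega>. ennreal (f n \<omega>) \<partial>M)"
    by (rule nn_integral_suminf) measurable
  also have "\<dots> = (\<Sum>n. ennreal (\<integral>\<omega>. f n \<omega> \<partial>M))"
    using int nn by (intro suminf_cong nn_integral_eq_integral) auto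
  also have "\<dots> = ennreal (\<Sum>n. \<integral>\<omega>. f n \<omega> \<partial>M)"
    by (rule suminf_ennreal2[OF _ sum]) (simp add: nn)
  finally have "(\<integral>\<^sup>+\<omega>. (\<Sum>n. ennreal (f n \<omega>)) \<partial>M) \<noteq> \<infinity>" by simp
  then have "AE \<omega> in M. (\<Sum>n. ennreal (f n \<omega>)) \<noteq> \<infinity>"
    by (rule nn_integral_PInf_AE[rotated]) measurable
  then show ?thesis
    by eventually_elim (auto intro: summable_suminf_not_top nn)
qed

lemma borel_measurable_fields:
  fixes X :: "'a \<Rightarrow> real ^ 'd::finite ^ 'm::finite"
  assumes [measurable]: "\<And>i v. (\<lambda>\<omega>. X \<omega> $ i $ v) \<in> borel_measurable F"
  shows "(\<lambda>\<omega>. transition_prob \<alpha> (X \<omega>) i v) \<in> borel_measurable F"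
    and "(\<lambda>\<omega>. energy \<alpha> (X \<omega>)) \<in> borel_measurable F"
    and "(\<lambda>\<omega>. energy_gradient \<alpha> (X \<omega>) i v) \<in> borel_measurable F"
    and "(\<lambda>\<omega>. dissipation \<alpha> (X \<omega>)) \<in> borel_measurable F"
proof -
  have u[measurable]: "(\<lambda>\<omega>. local_field \<alpha> (X \<omega>) i v) \<in> borel_measurable F" for i v
    unfolding local_field_def by measurable
  have Z[measurable]: "(\<lambda>\<omega>. partition_sum \<alpha> (X \<omega>) i) \<in> borel_measurable F" for i
    unfolding partition_sum_def by measurable
  have p[measurable]: "(\<lambda>\<omega>. transition_prob \<alpha> (X \<omega>) i v) \<in> borel_measurable F" for i v
    unfolding transition_prob_eq by measurable
  then show "(\<lambda>\<omega>. transition_prob \<alpha> (X \<omega>) i v) \<in> borel_measurable F" .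
  have r[measurable]: "(\<lambda>\<omega>. defect \<alpha> (X \<omega>) i v) \<in> borel_measurable F" for i v
    unfolding defect_def by measurable
  have m[measurable]: "(\<lambda>\<omega>. mean_defect \<alpha> (X \<omega>) i) \<in> borel_measurable F" for i
    unfolding mean_defect_def by measurable
  show "(\<lambda>\<omega>. energy \<alpha> (X \<omega>)) \<in> borel_measurable F" unfolding energy_def by measurable
  show "(\<lambda>\<omega>. energy_gradient \<alpha> (X \<omega>) i v) \<in> borel_measurable F"
    unfolding energy_gradient_def by measurable
  show "(\<lambda>\<omega>. dissipation \<alpha> (X \<omega>)) \<in> borel_measurable F" unfolding dissipation_def by measurable
qed

context interacting_walks
begin

lemma space_walk_history: "space (walk_history M W n) = space M"
  unfolding walk_history_def by (rule space_measure_of) auto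

lemma measurable_walk_history:
  assumes "1 \<le> k" "k \<le> n"
  shows "W k \<in> measurable (walk_history M W n) (count_space UNIV)"
proof (rule measurableI)
  fix A
  have "W k -` A \<inter> space M \<in> {W k -` A \<inter> space M |k A. 1 \<le> k \<and> k \<le> n}" using assms by blast
  then show "W k -` A \<inter> space (walk_history M W n) \<in> sets (walk_history M W n)"
    unfolding space_walk_history unfolding walk_history_def by (intro in_measure_of) auto
qed simp

lemma subalgebra_walk_history: "subalgebra M (walk_history M W n)"
  unfolding subalgebra_def
proof
  show "sets (walk_history M W n) \<subseteq> sets M"
  proof -
    have "{W k -` A \<inter> space M |k A. 1 \<le> k \<and> k \<le> n} \<subseteq> sets M"
      using measurable_sets[OF walk_measurable] by auto
    then have "sigma_sets (space M) {W k -` A \<inter> space M |k A. 1 \<le> k \<and> k \<le> n} \<subseteq> sets M"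
      by (rule sets.sigma_sets_subset)
    moreover have "{W k -` A \<inter> space M |k A. 1 \<le> k \<and> k \<le> n} \<subseteq> Pow (space M)" by blast
    ultimately show ?thesis by (simp only: walk_history_def sets_measure_of)
  qed
qed (rule space_walk_history)

lemma occupation_measure_measurable:
  "(\<lambda>\<omega>. occupation_measure W n \<omega> $ i $ v) \<in> borel_measurable (walk_history M W n)"
proof -
  have "(\<lambda>\<omega>. of_bool (W k \<omega> i = v) :: real) \<in> borel_measurable (walk_history M W n)"
    if "k \<in> {1..n}" for k
    using that measurable_compose[OF measurable_walk_history[of k n],
        of "\<lambda>w. of_bool (w i = v) :: real" borel] by simp
  then show ?thesis by (simp add: occupation_measure_def)
qed

lemma occupation_measure_measurable_M [measurable]:
  "(\<lambda>\<omega>. occupation_measure W n \<omega> $ i $ v) \<in> borel_measurable M"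
  by (rule measurable_from_subalg[OF subalgebra_walk_history occupation_measure_measurable])

lemma walk_indicator_measurable [measurable]:
  "(\<lambda>\<omega>. of_bool (W (Suc n) \<omega> i = v) :: real) \<in> borel_measurable M"
  using measurable_compose[OF walk_measurable[of "Suc n"],
      of "\<lambda>w. of_bool (w i = v) :: real" borel] by simp

lemma integrable_bounded:
  fixes f :: "'a \<Rightarrow> real"
  assumes "f \<in> borel_measurable M" "\<And>\<omega>. \<bar>f \<omega>\<bar> \<le> B"
  shows "integrable M f"
  using assms by (intro integrable_const_bound[where B = B]) auto

text \<open>
  A bounded function of the past may be multiplied into the conditional expectation that defines the
  transition rule.
\<close>

lemma expectation_next_position:
  fixes g :: "'a \<Rightarrow> real"
  assumes g: "g \<in> borel_measurable (walk_history M W n)" "\<And>\<omega>. \<bar>g \<omega>\<bar> \<le> B"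
  shows "expectation (\<lambda>\<omega>. g \<omega> * of_bool (W (Suc n) \<omega> i = v)) =
    expectation (\<lambda>\<omega>. g \<omega> * transition_prob \<alpha> (occupation_measure W n \<omega>) i v)"
proof -
  interpret F: finite_measure_subalgebra M "walk_history M W n"
    by unfold_locales (rule subalgebra_walk_history)
  have gM [measurable]: "g \<in> borel_measurable M"
    by (rule measurable_from_subalg[OF subalgebra_walk_history g(1)])
  let ?A = "{\<omega> \<in> space M. W (Suc n) \<omega> i = v}"
  have A: "?A \<in> sets M"
    using measurable_sets[OF walk_measurable[of "Suc n"], of "{w. w i = v}"]
    by (simp add: vimage_def Int_def conj_commute)
  have ind: "g \<omega> * indicator ?A \<omega> = g \<omega> * of_bool (W (Suc n) \<omega> i = v)" if "\<omega> \<in> space M" for \<omega>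
    using that by (simp add: indicator_def)
  have int: "integrable M (\<lambda>\<omega>. g \<omega> * indicator ?A \<omega>)"
    using A g(2)
    by (intro integrable_bounded[where B = B])
       (auto simp: indicator_def intro: order_trans[OF abs_ge_zero])
  have "expectation (\<lambda>\<omega>. g \<omega> * of_bool (W (Suc n) \<omega> i = v))
      = expectation (\<lambda>\<omega>. g \<omega> * indicator ?A \<omega>)"
    by (intro Bochner_Integration.integral_cong refl) (simp add: ind)
  also have "\<dots> = expectation (\<lambda>\<omega>. g \<omega> * real_cond_exp M (walk_history M W n) (indicator ?A) \<omega>)"
    using A by (intro F.real_cond_exp_intg(2)[symmetric] int g(1)) simp
  also have "\<dots> = expectation (\<lambda>\<omega>. g \<omega> * transition_prob \<alpha> (occupation_measure W n \<omega>) i v)"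
  proof (rule integral_cong_AE)
    show "AE \<omega> in M. g \<omega> * real_cond_exp M (walk_history M W n) (indicator ?A) \<omega>
        = g \<omega> * transition_prob \<alpha> (occupation_measure W n \<omega>) i v"
      using walk_transition[of n i v] unfolding cond_prob_given_def
      by eventually_elim simp
    show "(\<lambda>\<omega>. g \<omega> * transition_prob \<alpha> (occupation_measure W n \<omega>) i v) \<in> borel_measurable M"
      by (intro borel_measurable_times gM borel_measurable_fields(1)) measurable
    show "(\<lambda>\<omega>. g \<omega> * real_cond_exp M (walk_history M W n) (indicator ?A) \<omega>)
        \<in> borel_measurable M"
      by (intro borel_measurable_times gM borel_measurable_cond_exp2)
  qed
  finally show ?thesis .
qed

text \<open>
  The quadratic bound on the energy is linear in the increment of \<open>X\<close> up to an error of order \<open>\<gamma>\<^sup>2\<close>,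
  where \<open>\<gamma>\<close> is the step size, so in expectation the next position may be replaced by its
  conditional law \<open>p\<close>. What remains is the derivative of the energy along \<open>p - x\<close>, which is minus the dissipation.
\<close>

lemma expected_energy_step:
  assumes sym: "\<And>v i j. \<alpha> v i j = \<alpha> v j i"
  obtains C where "C \<ge> 0" "\<And>n. n \<ge> 1 \<Longrightarrow>
    expectation (\<lambda>\<omega>. energy \<alpha> (occupation_measure W (Suc n) \<omega>))
      \<le> expectation (\<lambda>\<omega>. energy \<alpha> (occupation_measure W n \<omega>))
        - 1 / (real CARD('d) + real n + 1)
          * expectation (\<lambda>\<omega>. dissipation \<alpha> (occupation_measure W n \<omega>))
        + C * (1 / (real CARD('d) + real n + 1)) ^ 2"
proof -
  obtain C where C: "C \<ge> 0" "\<And>x y. x \<in> simplices \<Longrightarrow> y \<in> simplices \<Longrightarrow>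
       energy \<alpha> y \<le> energy \<alpha> x +
         (\<Sum>j\<in>UNIV. \<Sum>v\<in>UNIV. energy_gradient \<alpha> x j v * (y - x) $ j $ v) + C * norm (y - x) ^ 2"
    by (rule energy_quadratic_bound[OF sym]) (rule that)
  show ?thesis
  proof (rule that[of "C * (real CARD('m) * real CARD('d)) ^ 2"])
    show "C * (real CARD('m) * real CARD('d)) ^ 2 \<ge> 0" using C(1) by simp
    fix n :: nat assume n: "n \<ge> 1"
    define \<gamma> where "\<gamma> = 1 / (real CARD('d) + real n + 1)"
    define X where "X = occupation_measure W n"
    define Y where "Y = occupation_measure W (Suc n)"
    define G where "G j v \<omega> = energy_gradient \<alpha> (X \<omega>) j v" for j v \<omega>
    define I where "I j v \<omega> = (of_bool (W (Suc n) \<omega> j = v) :: real)" for j v \<omega>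
    define p where "p j v \<omega> = transition_prob \<alpha> (X \<omega>) j v" for j v \<omega>
    have X: "X \<omega> \<in> simplices" and Y: "Y \<omega> \<in> simplices" for \<omega>
      using n by (simp_all add: X_def Y_def occupation_measure_in_simplices)
    have XM: "(\<lambda>\<omega>. X \<omega> $ i $ v) \<in> borel_measurable M"
      and YM: "(\<lambda>\<omega>. Y \<omega> $ i $ v) \<in> borel_measurable M" for i v
      unfolding X_def Y_def by (rule occupation_measure_measurable_M)+
    have IM: "I i v \<in> borel_measurable M" for i v
      unfolding I_def by (rule walk_indicator_measurable)
    have GM: "G i v \<in> borel_measurable M" for i v
      unfolding G_def by (rule borel_measurable_fields(3)[OF XM])
    have pM: "p i v \<in> borel_measurable M" for i v
      unfolding p_def by (rule borel_measurable_fields(1)[OF XM])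
    have GF: "G j v \<in> borel_measurable (walk_history M W n)" for j v
      unfolding G_def X_def by (intro borel_measurable_fields occupation_measure_measurable)
    have GB: "\<exists>B>0. \<forall>\<omega>. \<bar>G j v \<omega>\<bar> \<le> B" for j v
    proof -
      obtain B where "B > 0" "\<And>x. x \<in> simplices \<Longrightarrow> \<bar>energy_gradient \<alpha> x j v\<bar> \<le> B"
        using lipschitzian_bounded[OF lipschitzian_energy_gradient[OF compact_simplices]
            compact_simplices] by blast
      then show ?thesis using X unfolding G_def by blast
    qed
    have intG: "integrable M (\<lambda>\<omega>. G j v \<omega> * f \<omega>)"
      if f: "f \<in> borel_measurable M" "\<And>\<omega>. \<bar>f \<omega>\<bar> \<le> 1" for j v f
    proof -
      obtain B where B: "B > 0" "\<And>\<omega>. \<bar>G j v \<omega>\<bar> \<le> B" using GB[of j v] by blast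
      show ?thesis
      proof (rule integrable_bounded[where B = "B * 1"])
        show "\<bar>G j v \<omega> * f \<omega>\<bar> \<le> B * 1" for \<omega>
          unfolding abs_mult using B f by (intro mult_mono) (simp_all add: less_imp_le)
      qed (intro borel_measurable_times GM f)
    qed
    have bX: "\<bar>X \<omega> $ j $ v\<bar> \<le> 1" for j v \<omega>
      using X[of \<omega>] simplices_component_le_1[OF X] by (simp add: simplices_def)
    have bI: "\<bar>I j v \<omega>\<bar> \<le> 1" for j v \<omega> by (simp add: I_def)
    have bp: "\<bar>p j v \<omega>\<bar> \<le> 1" for j v \<omega>
      by (simp add: p_def transition_prob_le_1 transition_prob_pos less_imp_le)
    note ints = intG[OF IM bI] intG[OF XM bX] intG[OF pM bp]
    obtain B where B: "B > 0" "\<And>x. x \<in> simplices \<Longrightarrow> \<bar>energy \<alpha> x\<bar> \<le> B"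
      using lipschitzian_bounded[OF lipschitzian_energy[OF compact_simplices]
          compact_simplices] by blast
    have intE: "integrable M (\<lambda>\<omega>. energy \<alpha> (X \<omega>))" "integrable M (\<lambda>\<omega>. energy \<alpha> (Y \<omega>))"
      by (intro integrable_bounded[where B = B] borel_measurable_fields(2) XM YM B X Y)+
    have drift: "expectation (\<lambda>\<omega>. \<Sum>j\<in>UNIV. \<Sum>v\<in>UNIV. G j v \<omega> * (I j v \<omega> - X \<omega> $ j $ v))
        = - expectation (\<lambda>\<omega>. dissipation \<alpha> (X \<omega>))"
    proof -
      have "expectation (\<lambda>\<omega>. \<Sum>j\<in>UNIV. \<Sum>v\<in>UNIV. G j v \<omega> * (I j v \<omega> - X \<omega> $ j $ v))
          = (\<Sum>j\<in>UNIV. \<Sum>v\<in>UNIV. expectation (\<lambda>\<omega>. G j v \<omega> * I j v \<omega>)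
              - expectation (\<lambda>\<omega>. G j v \<omega> * X \<omega> $ j $ v))"
        by (simp add: right_diff_distrib ints)
      also have "\<dots> = (\<Sum>j\<in>UNIV. \<Sum>v\<in>UNIV. expectation (\<lambda>\<omega>. G j v \<omega> * p j v \<omega>)
              - expectation (\<lambda>\<omega>. G j v \<omega> * X \<omega> $ j $ v))"
      proof (intro sum.cong refl arg_cong2[where f = minus])
        fix j v
        obtain B where "\<And>\<omega>. \<bar>G j v \<omega>\<bar> \<le> B" using GB[of j v] by blast
        from expectation_next_position[OF GF this]
        show "expectation (\<lambda>\<omega>. G j v \<omega> * I j v \<omega>) = expectation (\<lambda>\<omega>. G j v \<omega> * p j v \<omega>)"
          by (simp add: I_def p_def X_def)
      qed
      also have "\<dots> = expectation (\<lambda>\<omega>. \<Sum>j\<in>UNIV. \<Sum>v\<in>UNIV. G j v \<omega> * (p j v \<omega> - X \<omega> $ j $ v))"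
        by (simp add: right_diff_distrib ints)
      finally show ?thesis by (simp add: G_def p_def sum_energy_gradient_drift)
    qed
    have intS: "integrable M (\<lambda>\<omega>. \<Sum>j\<in>UNIV. \<Sum>v\<in>UNIV. G j v \<omega> * (I j v \<omega> - X \<omega> $ j $ v))"
      by (simp add: right_diff_distrib ints)
    have "energy \<alpha> (Y \<omega>) \<le> energy \<alpha> (X \<omega>)
        + \<gamma> * (\<Sum>j\<in>UNIV. \<Sum>v\<in>UNIV. G j v \<omega> * (I j v \<omega> - X \<omega> $ j $ v))
        + C * (real CARD('m) * real CARD('d)) ^ 2 * \<gamma> ^ 2" for \<omega>
    proof -
      have "(\<Sum>j\<in>UNIV. \<Sum>v\<in>UNIV. energy_gradient \<alpha> (X \<omega>) j v * (Y \<omega> - X \<omega>) $ j $ v)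
          = \<gamma> * (\<Sum>j\<in>UNIV. \<Sum>v\<in>UNIV. G j v \<omega> * (I j v \<omega> - X \<omega> $ j $ v))"
        unfolding Y_def X_def occupation_measure_step[OF n]
        by (simp add: G_def I_def X_def \<gamma>_def sum_divide_distrib)
      moreover have "norm (Y \<omega> - X \<omega>) ^ 2 \<le> (real CARD('m) * real CARD('d) * \<gamma>) ^ 2"
        using norm_occupation_measure_step[OF n, of W \<omega>]
        by (intro power_mono) (simp_all add: X_def Y_def \<gamma>_def)
      then have "C * norm (Y \<omega> - X \<omega>) ^ 2 \<le> C * (real CARD('m) * real CARD('d)) ^ 2 * \<gamma> ^ 2"
        using mult_left_mono[OF _ C(1)] by (simp add: power_mult_distrib mult.assoc)
      ultimately show ?thesis using C(2)[OF X Y, of \<omega> \<omega>] by linarith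
    qed
    then have "expectation (\<lambda>\<omega>. energy \<alpha> (Y \<omega>)) \<le> expectation (\<lambda>\<omega>. energy \<alpha> (X \<omega>)
        + \<gamma> * (\<Sum>j\<in>UNIV. \<Sum>v\<in>UNIV. G j v \<omega> * (I j v \<omega> - X \<omega> $ j $ v))
        + C * (real CARD('m) * real CARD('d)) ^ 2 * \<gamma> ^ 2)"
      using intE intS
      by (intro integral_mono Bochner_Integration.integrable_add integrable_mult_right) simp_all
    also have "\<dots> = expectation (\<lambda>\<omega>. energy \<alpha> (X \<omega>))
        - \<gamma> * expectation (\<lambda>\<omega>. dissipation \<alpha> (X \<omega>))
        + C * (real CARD('m) * real CARD('d)) ^ 2 * \<gamma> ^ 2"
      using intE intS drift by (simp add: prob_space)
    finally show "expectation (\<lambda>\<omega>. energy \<alpha> (occupation_measure W (Suc n) \<omega>))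
      \<le> expectation (\<lambda>\<omega>. energy \<alpha> (occupation_measure W n \<omega>))
        - 1 / (real CARD('d) + real n + 1)
          * expectation (\<lambda>\<omega>. dissipation \<alpha> (occupation_measure W n \<omega>))
        + C * (real CARD('m) * real CARD('d)) ^ 2 * (1 / (real CARD('d) + real n + 1)) ^ 2"
      by (simp add: X_def Y_def \<gamma>_def)
  qed
qed

text \<open>
  Summing the expected energy balance over time, the bounded energy and the summable squared step sizes
  leave \<open>\<Sum> \<gamma> n * E (D n) < \<infinity>\<close>, where \<open>D n\<close> is the dissipation at time \<open>n\<close>. Hence
  \<open>\<Sum> \<gamma> n * D n < \<infinity>\<close> almost surely, and since each step moves \<open>X\<close> by at most a multiple of
  \<open>\<gamma> n\<close> on every path, \<open>null_sequence_of_slow_variation\<close> applies path by path.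
\<close>

theorem dissipation_tendsto_0:
  assumes sym: "\<And>v i j. \<alpha> v i j = \<alpha> v j i"
  shows "AE \<omega> in M. (\<lambda>n. dissipation \<alpha> (occupation_measure W n \<omega>)) \<longlonglongrightarrow> 0"
proof -
  define \<gamma> where "\<gamma> n = 1 / (real CARD('d) + real (Suc n) + 1)" for n
  \<comment> \<open>The shift by one skips time 0, at which \<open>X\<close> does not lie in the simplices.\<close>
  define Y where "Y n = occupation_measure W (Suc n)" for n
  have Y: "Y n \<omega> \<in> simplices" for n \<omega> by (simp add: Y_def occupation_measure_in_simplices)
  have Ym: "(\<lambda>\<omega>. Y n \<omega> $ i $ v) \<in> borel_measurable M" for n i v unfolding Y_def by measurable
  have shift: "\<gamma> = (\<lambda>n. inverse (real (n + (CARD('d) + 2))))"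
    by (simp add: \<gamma>_def fun_eq_iff inverse_eq_divide ac_simps)
  have \<gamma>0: "\<gamma> n \<ge> 0" for n by (simp add: \<gamma>_def)
  have \<gamma>1: "\<not> summable \<gamma>"
    unfolding shift using not_summable_harmonic[where 'a = real]
    by (subst summable_iff_shift[where f = "\<lambda>n. inverse (real n)"])
  have \<gamma>2: "summable (\<lambda>n. \<gamma> n ^ 2)"
    unfolding shift
    by (subst summable_iff_shift[where f = "\<lambda>n. inverse (real n) ^ 2"])
       (use inverse_power_summable[of 2, where 'a = real] in \<open>simp add: power_inverse\<close>)
  obtain C where C: "C \<ge> 0" "\<And>n. n \<ge> 1 \<Longrightarrow>
    expectation (\<lambda>\<omega>. energy \<alpha> (occupation_measure W (Suc n) \<omega>))
      \<le> expectation (\<lambda>\<omega>. energy \<alpha> (occupation_measure W n \<omega>))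
        - 1 / (real CARD('d) + real n + 1)
          * expectation (\<lambda>\<omega>. dissipation \<alpha> (occupation_measure W n \<omega>))
        + C * (1 / (real CARD('d) + real n + 1)) ^ 2"
    using expected_energy_step[OF sym] by metis
  obtain B where B: "B > 0" "\<And>x. x \<in> simplices \<Longrightarrow> \<bar>energy \<alpha> x\<bar> \<le> B"
    using lipschitzian_bounded[OF lipschitzian_energy[OF compact_simplices]
        compact_simplices] by blast
  obtain B' where B': "B' > 0" "\<And>x. x \<in> simplices \<Longrightarrow> \<bar>dissipation \<alpha> x\<bar> \<le> B'"
    using lipschitzian_bounded[OF lipschitzian_dissipation[OF compact_simplices]
        compact_simplices] by blast
  obtain L where L: "L \<ge> 0" "\<And>x y. x \<in> simplices \<Longrightarrow> y \<in> simplices \<Longrightarrow>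
      \<bar>dissipation \<alpha> x - dissipation \<alpha> y\<bar> \<le> L * dist x y"
    using lipschitzianE[OF lipschitzian_dissipation[OF compact_simplices]] by blast
  define a where "a n = expectation (\<lambda>\<omega>. energy \<alpha> (Y n \<omega>))" for n
  define b where "b n = expectation (\<lambda>\<omega>. \<gamma> n * dissipation \<alpha> (Y n \<omega>))" for n
  have intD: "integrable M (\<lambda>\<omega>. \<gamma> n * dissipation \<alpha> (Y n \<omega>))" for n
    by (intro integrable_mult_right integrable_bounded[where B = B'] borel_measurable_fields(4)
        Ym B' Y)
  have intE: "integrable M (\<lambda>\<omega>. energy \<alpha> (Y n \<omega>))" for n
    by (intro integrable_bounded[where B = B] borel_measurable_fields(2) Ym B Y)
  have a_abs: "\<bar>a n\<bar> \<le> B" for n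
  proof -
    have "\<bar>a n\<bar> \<le> expectation (\<lambda>\<omega>. \<bar>energy \<alpha> (Y n \<omega>)\<bar>)"
      unfolding a_def by (rule integral_abs_bound)
    also have "\<dots> \<le> expectation (\<lambda>\<omega>. B)"
      by (intro integral_mono integrable_abs intE) (simp_all add: B Y)
    finally show ?thesis by (simp add: prob_space)
  qed
  have step: "b n \<le> a n - a (Suc n) + C * \<gamma> n ^ 2" for n
    using C(2)[of "Suc n"] by (simp add: a_def b_def Y_def \<gamma>_def)
  have b0: "b n \<ge> 0" for n
    unfolding b_def
    by (intro integral_nonneg_AE AE_I2 mult_nonneg_nonneg \<gamma>0 dissipation_nonneg)
  have "summable b"
  proof (rule summableI_nonneg_bounded[OF b0])
    fix N
    have "(\<Sum>n<N. b n) \<le> (\<Sum>n<N. a n - a (Suc n) + C * \<gamma> n ^ 2)" by (intro sum_mono step)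
    also have "\<dots> = a 0 - a N + C * (\<Sum>n<N. \<gamma> n ^ 2)"
      by (simp add: sum.distrib sum_lessThan_telescope' sum_distrib_left)
    also have "\<dots> \<le> 2 * B + C * (\<Sum>n. \<gamma> n ^ 2)"
      using a_abs[of 0] a_abs[of N] mult_left_mono[OF sum_le_suminf[OF \<gamma>2, of "{..<N}"] C(1)]
      by simp
    finally show "(\<Sum>n<N. b n) \<le> 2 * B + C * (\<Sum>n. \<gamma> n ^ 2)" .
  qed
  then have "AE \<omega> in M. summable (\<lambda>n. \<gamma> n * dissipation \<alpha> (Y n \<omega>))"
    unfolding b_def
    by (intro AE_summable_of_summable_expectation intD mult_nonneg_nonneg \<gamma>0 dissipation_nonneg)
  then show ?thesis
  proof eventually_elim
    case (elim \<omega>)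
    have "(\<lambda>n. dissipation \<alpha> (Y n \<omega>)) \<longlonglongrightarrow> 0"
    proof (rule null_sequence_of_slow_variation[OF \<gamma>0 \<gamma>1 \<gamma>2 dissipation_nonneg elim])
      fix n
      have "\<bar>dissipation \<alpha> (Y (Suc n) \<omega>) - dissipation \<alpha> (Y n \<omega>)\<bar>
          \<le> L * dist (Y (Suc n) \<omega>) (Y n \<omega>)"
        by (intro L Y)
      also have "\<dots> \<le> L * (real CARD('m) * real CARD('d) * \<gamma> n)"
        using norm_occupation_measure_step[of "Suc n" W \<omega>] L(1)
        by (intro mult_left_mono) (simp_all add: dist_norm Y_def \<gamma>_def)
      finally show "\<bar>dissipation \<alpha> (Y (Suc n) \<omega>) - dissipation \<alpha> (Y n \<omega>)\<bar>
          \<le> L * (real CARD('m) * real CARD('d)) * \<gamma> n" by (simp add: mult.assoc)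
    qed
    then show ?case unfolding Y_def by (rule LIMSEQ_imp_Suc)
  qed
qed

end

section \<open>Convergence of repelling walks\<close>

theorem theorem3:
  fixes M :: "'a measure"
    and \<alpha> :: "'d::finite \<Rightarrow> 'm::finite \<Rightarrow> 'm \<Rightarrow> real"
    and W :: "nat \<Rightarrow> 'a \<Rightarrow> 'm \<Rightarrow> 'd"
    and \<beta> :: real
  assumes "\<beta> > 0"
    and "\<And>v i j. \<alpha> v i j = - \<beta> * (1 - of_bool (i = j))"
    and "interacting_walks M \<alpha> W"
    and "(CARD('d) = 2 \<and> CARD('m) \<ge> 2 \<and> \<beta> \<le> 2) \<or>
         (CARD('d) \<ge> 2 \<and> CARD('m) \<ge> 2 \<and>
          \<beta> < 4 / (real CARD('d) * (real CARD('m) - 1)))"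
  shows "AE \<omega> in M. (\<lambda>n. occupation_measure W n \<omega>) \<longlonglongrightarrow> (\<chi> i v. 1 / real CARD('d))"
proof -
  interpret interacting_walks M \<alpha> W by fact
  have m: "CARD('m) \<ge> 2" using assms(4) by blast
  \<comment> \<open>In the second case the denominator is at least 2.\<close>
  have \<beta>: "\<beta> \<le> 2"
    using assms(4)
  proof
    assume *: "CARD('d) \<ge> 2 \<and> CARD('m) \<ge> 2 \<and> \<beta> < 4 / (real CARD('d) * (real CARD('m) - 1))"
    then have "2 * 1 \<le> real CARD('d) * (real CARD('m) - 1)" by (intro mult_mono) simp_all
    then have "4 / (real CARD('d) * (real CARD('m) - 1)) \<le> 4 / 2"
      by (intro divide_left_mono) simp_all
    then show ?thesis using * by linarith
  qed blast
  have "AE \<omega> in M. (\<lambda>n. dissipation \<alpha> (occupation_measure W n \<omega>)) \<longlonglongrightarrow> 0"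
    by (rule dissipation_tendsto_0) (simp add: assms(2) eq_commute)
  then show ?thesis
  proof eventually_elim
    case (elim \<omega>)
    have "(\<lambda>n. occupation_measure W (Suc n) \<omega>) \<longlonglongrightarrow> (\<chi> i v. 1 / real CARD('d))"
    proof (rule tendsto_unique_zero_compact[OF compact_simplices])
      show "continuous_on simplices (dissipation \<alpha>)"
        by (rule lipschitzian_continuous_on[OF lipschitzian_dissipation[OF compact_simplices]])
      show "(\<lambda>n. dissipation \<alpha> (occupation_measure W (Suc n) \<omega>)) \<longlonglongrightarrow> 0"
        using elim by (rule LIMSEQ_Suc)
      show "x = (\<chi> i v. 1 / real CARD('d))"
        if "x \<in> simplices" "dissipation \<alpha> x = 0" for x
        by (rule repelling_dissipation_eq_0_imp[OF assms(1) \<beta> m assms(2) that])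
    qed (simp_all add: occupation_measure_in_simplices dissipation_nonneg)
    then show ?case by (rule LIMSEQ_imp_Suc)
  qed
qed

end
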